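(* Let $x^0\in\mathrm{dom}(F)$, $\beta\in(0,(3-\sqrt5)/2)$ and $\epsilon>0$ be given. Then the mixture of damped Newton (DN) and Newton methods (described in the context) for solving $\min_x\{f(x)+g(x)\}$ with $g=0$ requires at most $$\min\left\{\left\lceil\left[\frac{\log(\omega(\beta))-\log\delta_0}{\log\left(1-\frac{1-\omega_*^{-1}(\delta_0)}{1+\omega_*^{-1}(\delta_0)}\right)}\right]_+\right\rceil,\ \left\lceil\frac{\delta_0}{\omega(\beta)}\right\rceil\right\}+\left\lceil\log_2\left(\frac{\log\epsilon-2\log(1-\beta)}{\log\beta-2\log(1-\beta)}\right)\right\rceil$$ iterations for finding some $x^k$ satisfying $\tilde\lambda(x^k)\le\epsilon$, where $\delta_0=F(x^0)-F^*$.
   Context: Problem and standing assumptions. Here $g=0$, so $F=f$ and $F^*=\min_{x\in\mathbb{R}^N}f(x)$, where $f:\mathbb{R}^N\to\mathbb{R}\cup\{\infty\}$ is standard self-concordant: it is a closed convex function with open domain $\mathrm{dom}(f)$, three times continuously differentiable on $\mathrm{dom}(f)$, and $|\psi'''(0)|\le 2(\psi''(0))^{3/2}$ for all $x\in\mathrm{dom}(f)$, $u\in\mathbb{R}^N$, where $\psi(t)=f(x+tu)$. Also $\nabla^2 f$ is positive definite on $\mathrm{dom}(F)$, and the problem has a unique optimal solution $x^*$ (so $F^*=F(x^* )$). Method. Let $\tilde d(x):=-(\nabla^2 f(x))^{-1}\nabla f(x)$ and $\tilde\lambda(x):=\sqrt{\langle\tilde d(x),\nabla^2 f(x)\tilde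 d(x)\rangle}$. First stage: starting at $x^0$, perform DN iterations $x^{k+1}=x^k+\tilde d(x^k)/(1+\tilde\lambda(x^k))$ until finding some $x^{K_1}$ with $\tilde\lambda(x^{K_1})\le\beta$. Second stage: starting at $x^{K_1}$, perform Newton iterations $x^{k+1}=x^k+\tilde d(x^k)$, terminating at some $x^{K_2}$ with $\tilde\lambda(x^{K_2})\le\epsilon$. The number of iterations is the total number $K_2$ over both stages. Notation. $\omega(t):=t-\ln(1+t)$; $\omega_*(t):=-t-\ln(1-t)$; $\omega_*^{-1}:[0,\infty)\to[0,1)$ is the inverse of $\omega_*$ restricted to $[0,1)$; $[t]_+:=\max(t,0)$.
   Formalization: For ε > β the log₂ ceiling term is replaced by 0 (the second stage is then empty), because there the printed term can be negative, making the bound false for x⁰ near x*, or is undefined once ε ≥ (1−β)²; for ε ≤ β the formula is as stated. *)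

theory Defs
  imports "HOL-Analysis.Analysis"
begin

definition gradient :: "(real^'n \<Rightarrow> real) \<Rightarrow> real^'n \<Rightarrow> real^'n" where
  "gradient h x = (THE D. GDERIV h x :> D)"

definition hessian :: "(real^'n \<Rightarrow> real) \<Rightarrow> real^'n \<Rightarrow> real^'n^'n" where
  "hessian h x = jacobian (gradient h) (at x)"

text \<open>A symmetry clause would be redundant: the matrices of interest are Hessians of
  three times continuously differentiable functions.\<close>
definition positive_definite :: "real^'n^'n \<Rightarrow> bool" where
  "positive_definite A \<longleftrightarrow> (\<forall>u. u \<noteq> 0 \<longrightarrow> u \<bullet> (A *v u) > 0)"

text \<open>\<open>k\<close> times continuously differentiable on \<open>S\<close>; meant for open \<open>S\<close>, since the
  derivatives are taken with respect to full neighbourhoods.\<close>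
primrec cont_differentiable_on :: "nat \<Rightarrow> (real^'n \<Rightarrow> real) \<Rightarrow> (real^'n) set \<Rightarrow> bool" where
  "cont_differentiable_on 0 h S \<longleftrightarrow> continuous_on S h"
| "cont_differentiable_on (Suc k) h S \<longleftrightarrow>
     (\<forall>x\<in>S. h differentiable (at x)) \<and>
     (\<forall>v. cont_differentiable_on k (\<lambda>x. frechet_derivative h (at x) v) S)"

text \<open>Functions with values in the reals and infinity are functions into \<^typ>\<open>ereal\<close> that
  avoid minus infinity. Derivatives are those of the real-valued representative
  \<open>real_part\<close>, which is meaningful on the effective domain \<open>edom\<close> only.\<close>
definition edom :: "(real^'n \<Rightarrow> ereal) \<Rightarrow> (real^'n) set" where
  "edom f = {x. f x < \<infinity>}"

definition real_part :: "(real^'n \<Rightarrow> ereal) \<Rightarrow> real^'n \<Rightarrow> real" where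
  "real_part f x = real_of_ereal (f x)"

definition standard_self_concordant :: "(real^'n \<Rightarrow> ereal) \<Rightarrow> bool" where
  "standard_self_concordant f \<longleftrightarrow>
     (\<forall>x. f x \<noteq> -\<infinity>) \<and>
     closed (epigraph (edom f) (real_part f)) \<and>
     convex_on (edom f) (real_part f) \<and>
     open (edom f) \<and>
     cont_differentiable_on 3 (real_part f) (edom f) \<and>
     (\<forall>x\<in>edom f. \<forall>u. let \<psi> = (\<lambda>t. real_part f (x + t *\<^sub>R u)) in
        \<bar>(deriv ^^ 3) \<psi> 0\<bar> \<le> 2 * ((deriv ^^ 2) \<psi> 0) powr (3/2))"

definition unique_minimizer :: "(real^'n \<Rightarrow> ereal) \<Rightarrow> real^'n \<Rightarrow> bool" where
  "unique_minimizer f z \<longleftrightarrow> (\<forall>y. f z \<le> f y) \<and> (\<forall>z'. (\<forall>y. f z' \<le> f y) \<longrightarrow> z' = z)"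

definition newton_dir :: "(real^'n \<Rightarrow> ereal) \<Rightarrow> real^'n \<Rightarrow> real^'n" where
  "newton_dir f x = - (matrix_inv (hessian (real_part f) x) *v gradient (real_part f) x)"

definition newton_decrement :: "(real^'n \<Rightarrow> ereal) \<Rightarrow> real^'n \<Rightarrow> real" where
  "newton_decrement f x =
     sqrt (newton_dir f x \<bullet> (hessian (real_part f) x *v newton_dir f x))"

text \<open>A terminating run: \<open>K1\<close> damped Newton steps up to the first iterate with decrement at
  most \<open>\<beta>\<close>, then \<open>K2 - K1\<close> full Newton steps up to the first iterate with decrement at
  most \<open>\<epsilon>\<close>. All iterates are required to lie in the domain, where the step is defined.
  The values of \<open>x\<close> beyond \<open>K2\<close> are irrelevant.\<close>
definition mixed_newton_run ::
  "(real^'n \<Rightarrow> ereal) \<Rightarrow> real^'n \<Rightarrow> real \<Rightarrow> real \<Rightarrow> (nat \<Rightarrow> real^'n) \<Rightarrow> nat \<Rightarrow> nat \<Rightarrow> bool" where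
  "mixed_newton_run f x0 \<beta> \<epsilon> x K1 K2 \<longleftrightarrow>
     x 0 = x0 \<and> K1 \<le> K2 \<and> (\<forall>k\<le>K2. x k \<in> edom f) \<and>
     (\<forall>k<K1. newton_decrement f (x k) > \<beta> \<and>
        x (Suc k) = x k + (1 / (1 + newton_decrement f (x k))) *\<^sub>R newton_dir f (x k)) \<and>
     newton_decrement f (x K1) \<le> \<beta> \<and>
     (\<forall>k. K1 \<le> k \<and> k < K2 \<longrightarrow> newton_decrement f (x k) > \<epsilon> \<and>
        x (Suc k) = x k + newton_dir f (x k)) \<and>
     newton_decrement f (x K2) \<le> \<epsilon>"

definition omega :: "real \<Rightarrow> real" where
  "omega t = t - ln (1 + t)"

definition omega_star :: "real \<Rightarrow> real" where
  "omega_star t = - t - ln (1 - t)"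

definition omega_star_inv :: "real \<Rightarrow> real" where
  "omega_star_inv = the_inv_into {0..<1} omega_star"

text \<open>For zero initial gap \<open>\<delta>\<^sub>0\<close> the first argument of the minimum contains the
  logarithm of zero; as both arguments are nonnegative and the second is then zero, the minimum
  is zero whatever value the first one takes.\<close>
definition first_stage_bound :: "real \<Rightarrow> real \<Rightarrow> int" where
  "first_stage_bound \<beta> \<delta>\<^sub>0 =
     min \<lceil>max 0 ((ln (omega \<beta>) - ln \<delta>\<^sub>0) /
            ln (1 - (1 - omega_star_inv \<delta>\<^sub>0) / (1 + omega_star_inv \<delta>\<^sub>0)))\<rceil>
         \<lceil>\<delta>\<^sub>0 / omega \<beta>\<rceil>"

text \<open>For \<open>\<epsilon> > \<beta>\<close> the second stage is empty, but the formula in the first branch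
  is then nonpositive and possibly negative, or (from \<open>\<epsilon> = (1 - \<beta>)\<^sup>2\<close> on) the
  outer logarithm is undefined. A count of iterations is read as zero in that range.\<close>
definition second_stage_bound :: "real \<Rightarrow> real \<Rightarrow> int" where
  "second_stage_bound \<beta> \<epsilon> =
     (if \<epsilon> \<le> \<beta>
      then \<lceil>log 2 ((ln \<epsilon> - 2 * ln (1 - \<beta>)) / (ln \<beta> - 2 * ln (1 - \<beta>)))\<rceil>
      else 0)"

end

theory Submission
  imports Defs
begin

text \<open>
Write \<open>|u|\<^sub>x\<close> for the norm that the Hessian of \<open>f\<close> at \<open>x\<close> defines, \<open>\<mu>(x)\<close> for the Newton
decrement, which is the local norm of the Newton direction \<open>d(x)\<close>, and \<open>\<delta>(x)\<close> for the gap
between \<open>f x\<close> and the minimum.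

Along a line, self-concordance says that the reciprocal of \<open>|u|\<close> at \<open>x + t u\<close>, as a function of
\<open>t\<close>, has slope between \<open>-1\<close> and \<open>1\<close>. Integrating this once gives
\<open>r / (1 + t r) \<le> |u| \<le> r / (1 - t r)\<close> for \<open>r = |u|\<^sub>x\<close>; integrating twice more encloses \<open>f\<close>
between its linearisation plus \<open>omega (t r)\<close> and its linearisation plus \<open>omega_star (t r)\<close>. The
upper bound cannot blow up before \<open>t r = 1\<close>, so a closed epigraph forces the whole open unit
ball of the norm at \<open>x\<close> (the Dikin ellipsoid) into the domain, and every step of either kind is legitimate
(lemma \<open>Dikin_ellipsoid_in_domain\<close>).

For the first stage, inserting the damped step into the upper bound shows that it lowers \<open>f\<close> by at
least \<open>omega (\<mu>(x))\<close>, hence by more than \<open>omega \<beta>\<close> while the stage lasts; this is the bound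
\<open>\<delta>\<^sub>0 / omega \<beta>\<close>. Minimising the lower bound over the
step gives \<open>\<delta>(x) \<le> omega_star (\<mu>(x))\<close> if \<open>\<mu>(x) < 1\<close>, so the decrease is at least \<open>omega t\<close> for the \<open>t\<close> with
\<open>omega_star t = \<delta>(x)\<close>. As \<open>omega t\<close> is at least \<open>(1 - t) / (1 + t)\<close> times \<open>omega_star t\<close>, the gap
shrinks by a fixed factor in each step, and since it still exceeds \<open>omega \<beta>\<close> before the last step,
the logarithmic bound follows (lemma \<open>first_stage_count\<close>).

For the second stage the point is \<open>\<mu>(x + d(x)) \<le> (\<mu>(x) / (1 - \<mu>(x)))\<^sup>2\<close>, lemma \<open>newton_step\<close>. It
comes from a second-order Taylor estimate of the gradient at \<open>x + d(x)\<close> in a direction \<open>u\<close>, and so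
needs the third derivative in the mixed directions \<open>d, d, u\<close>, whereas self-concordance speaks of
equal directions only. For a symmetric trilinear form on a Euclidean space the bound on the diagonal
implies the mixed bound with the same constant (lemma \<open>trilinear_mixed_bound\<close>), and the third
derivative is symmetric by Schwarz's theorem. Below the threshold on \<open>\<beta>\<close> one has \<open>\<beta> < (1 - \<beta>)\<^sup>2\<close>, and
then each step takes the quotient \<open>\<mu> / (1 - \<beta>)\<^sup>2\<close>, which starts below one, to at most its square: the number
of steps is doubly logarithmic in \<open>\<epsilon>\<close> (lemma \<open>second_stage_count\<close>).

Both counts hold for every initial piece of a stage, so they also show that the method terminates.
\<close>

section \<open>Directional derivatives and their symmetry\<close>

definition dir_deriv :: "(real^'n \<Rightarrow> real) \<Rightarrow> real^'n \<Rightarrow> real^'n \<Rightarrow> real" where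
  "dir_deriv h v x = frechet_derivative h (at x) v"

lemma cont_differentiable_on_Suc_dir_deriv:
  "cont_differentiable_on (Suc k) h S \<longleftrightarrow>
     (\<forall>x\<in>S. h differentiable (at x)) \<and> (\<forall>v. cont_differentiable_on k (dir_deriv h v) S)"
  by (simp add: dir_deriv_def [abs_def])

lemma has_derivative_dir_deriv:
  assumes "h differentiable (at x)"
  shows "(h has_derivative (\<lambda>v. dir_deriv h v x)) (at x)"
  using assms unfolding dir_deriv_def frechet_derivative_works by simp

lemma linear_dir_deriv:
  assumes "h differentiable (at x)"
  shows "linear (\<lambda>v. dir_deriv h v x)"
  using has_derivative_dir_deriv [OF assms] by (rule has_derivative_linear)

lemma dir_deriv_eqI:
  assumes "(h has_derivative h') (at x)"
  shows "dir_deriv h v x = h' v"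
  using frechet_derivative_at [OF assms] by (simp add: dir_deriv_def)

lemma dir_deriv_cong_open:
  assumes "open S" "x \<in> S" "\<And>y. y \<in> S \<Longrightarrow> h y = g y" "g differentiable (at x)"
  shows "dir_deriv h v x = dir_deriv g v x"
proof (rule dir_deriv_eqI)
  show "(h has_derivative (\<lambda>v. dir_deriv g v x)) (at x)"
    using has_derivative_dir_deriv [OF assms(4)] assms(1,2)
    by (rule has_derivative_transform_within_open) (simp add: assms(3))
qed

lemma has_real_derivative_along_line:
  assumes "h differentiable (at (x + t *\<^sub>R u))"
  shows "((\<lambda>t. h (x + t *\<^sub>R u)) has_real_derivative dir_deriv h u (x + t *\<^sub>R u)) (at t)"
proof -
  let ?L = "\<lambda>v. dir_deriv h v (x + t *\<^sub>R u)"
  have "((\<lambda>t. h (x + t *\<^sub>R u)) has_derivative (\<lambda>s. ?L (s *\<^sub>R u))) (at t)"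
  proof (rule has_derivative_compose [where g = h])
    show "((\<lambda>t. x + t *\<^sub>R u) has_derivative (\<lambda>s. s *\<^sub>R u)) (at t)"
      by (auto intro!: derivative_eq_intros)
    show "(h has_derivative ?L) (at (x + t *\<^sub>R u))"
      using assms by (rule has_derivative_dir_deriv)
  qed
  then show ?thesis
    using linear_scale [OF linear_dir_deriv [OF assms]]
    by (simp add: has_field_derivative_def mult_commute_abs)
qed

lemma cont_differentiable_on_Suc_imp:
  "cont_differentiable_on (Suc k) h S \<Longrightarrow> cont_differentiable_on k h S"
proof (induction k arbitrary: h)
  case 0
  then have "\<And>x. x \<in> S \<Longrightarrow> isCont h x"
    by (simp add: differentiable_imp_continuous_within)
  then show ?case
    by (simp add: continuous_at_imp_continuous_on)
next
  case (Suc k)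
  then show ?case
    by (metis cont_differentiable_on_Suc_dir_deriv)
qed

text \<open>The second difference of \<open>g\<close> over the parallelogram spanned by \<open>s v\<close> and \<open>s w\<close> is a mixed second
derivative at an interior point: apply the mean value theorem in direction \<open>v\<close> to the increment of
\<open>g\<close> in direction \<open>w\<close>, and then in direction \<open>w\<close> to the derivative in direction \<open>v\<close>.\<close>

lemma second_difference_mean_value:
  assumes "0 < s"
    and dom: "\<And>a b. 0 \<le> a \<Longrightarrow> a \<le> s \<Longrightarrow> 0 \<le> b \<Longrightarrow> b \<le> s \<Longrightarrow> x + a *\<^sub>R v + b *\<^sub>R w \<in> S"
    and g: "\<And>y. y \<in> S \<Longrightarrow> g differentiable (at y)"
    and dg: "\<And>y. y \<in> S \<Longrightarrow> dir_deriv g v differentiable (at y)"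
  obtains a b where "0 < a" "a < s" "0 < b" "b < s"
    "g (x + s *\<^sub>R v + s *\<^sub>R w) - g (x + s *\<^sub>R v) - (g (x + s *\<^sub>R w) - g x)
       = s\<^sup>2 * dir_deriv (dir_deriv g v) w (x + a *\<^sub>R v + b *\<^sub>R w)"
proof -
  let ?p = "\<lambda>a. g ((x + s *\<^sub>R w) + a *\<^sub>R v) - g (x + a *\<^sub>R v)"
  have "\<exists>a. a > 0 \<and> a < s \<and> ?p s - ?p 0
      = (s - 0) * (dir_deriv g v ((x + s *\<^sub>R w) + a *\<^sub>R v) - dir_deriv g v (x + a *\<^sub>R v))"
  proof (rule MVT2 [OF \<open>0 < s\<close>])
    fix a :: real assume a: "0 \<le> a" "a \<le> s"
    have "(x + s *\<^sub>R w) + a *\<^sub>R v \<in> S" "x + a *\<^sub>R v \<in> S"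
      using dom [OF a, of s] dom [OF a, of 0] \<open>0 < s\<close> by (simp_all add: algebra_simps)
    then show "(?p has_real_derivative
        (dir_deriv g v ((x + s *\<^sub>R w) + a *\<^sub>R v) - dir_deriv g v (x + a *\<^sub>R v))) (at a)"
      by (intro DERIV_diff has_real_derivative_along_line g)
  qed
  then obtain a where a: "0 < a" "a < s" and eq1: "?p s - ?p 0
      = s * (dir_deriv g v ((x + s *\<^sub>R w) + a *\<^sub>R v) - dir_deriv g v (x + a *\<^sub>R v))"
    by auto
  let ?q = "\<lambda>b. dir_deriv g v ((x + a *\<^sub>R v) + b *\<^sub>R w)"
  have "\<exists>b. b > 0 \<and> b < s \<and> ?q s - ?q 0
      = (s - 0) * dir_deriv (dir_deriv g v) w ((x + a *\<^sub>R v) + b *\<^sub>R w)"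
  proof (rule MVT2 [OF \<open>0 < s\<close>])
    fix b :: real assume b: "0 \<le> b" "b \<le> s"
    show "(?q has_real_derivative
        dir_deriv (dir_deriv g v) w ((x + a *\<^sub>R v) + b *\<^sub>R w)) (at b)"
      using dom [of a b] a b by (intro has_real_derivative_along_line dg) auto
  qed
  then obtain b where b: "0 < b" "b < s" and eq2: "?q s - ?q 0
      = s * dir_deriv (dir_deriv g v) w ((x + a *\<^sub>R v) + b *\<^sub>R w)"
    by auto
  have "?p s - ?p 0 = s * (?q s - ?q 0)"
    unfolding eq1 by (simp add: algebra_simps)
  then have "?p s - ?p 0 = s\<^sup>2 * dir_deriv (dir_deriv g v) w (x + a *\<^sub>R v + b *\<^sub>R w)"
    unfolding eq2 by (simp add: power2_eq_square)
  moreover have "?p s - ?p 0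
      = g (x + s *\<^sub>R v + s *\<^sub>R w) - g (x + s *\<^sub>R v) - (g (x + s *\<^sub>R w) - g x)"
    by (simp add: algebra_simps)
  ultimately show thesis
    using that [OF a b] by simp
qed

text \<open>Schwarz's theorem. The second difference is symmetric in \<open>v\<close> and \<open>w\<close>, so the two mixed derivatives
agree at points arbitrarily close to \<open>x\<close>; continuity carries this to \<open>x\<close> itself.\<close>

lemma dir_deriv_commute:
  assumes "open S" "x \<in> S" and C2: "cont_differentiable_on 2 g S"
  shows "dir_deriv (dir_deriv g v) w x = dir_deriv (dir_deriv g w) v x"
proof (rule ccontr)
  let ?A = "dir_deriv (dir_deriv g v) w" and ?B = "dir_deriv (dir_deriv g w) v"
  assume ne: "?A x \<noteq> ?B x"
  have C2': "cont_differentiable_on (Suc (Suc 0)) g S"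
    using C2 by (simp add: numeral_2_eq_2)
  have g: "g differentiable (at y)" if "y \<in> S" for y
    using C2' that by simp
  have dg: "dir_deriv g u differentiable (at y)" if "y \<in> S" for y u
    using C2' that unfolding cont_differentiable_on_Suc_dir_deriv by blast
  have "continuous_on S (dir_deriv (dir_deriv g u) u')" for u u'
    using C2' by (simp only: cont_differentiable_on_Suc_dir_deriv cont_differentiable_on.simps(1))
  then have cont: "isCont (dir_deriv (dir_deriv g u) u') x" for u u'
    using assms(1,2) by (simp add: continuous_on_eq_continuous_at)
  define e where "e = \<bar>?A x - ?B x\<bar> / 2"
  have "e > 0"
    using ne by (simp add: e_def)
  obtain d1 where d1: "d1 > 0" "\<And>y. dist y x < d1 \<Longrightarrow> dist (?A y) (?A x) < e"
    using cont [of v w] \<open>e > 0\<close> unfolding continuous_at_eps_delta by blast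
  obtain d2 where d2: "d2 > 0" "\<And>y. dist y x < d2 \<Longrightarrow> dist (?B y) (?B x) < e"
    using cont [of w v] \<open>e > 0\<close> unfolding continuous_at_eps_delta by blast
  obtain d3 where d3: "d3 > 0" "\<And>y. dist y x < d3 \<Longrightarrow> y \<in> S"
    using assms(1,2) unfolding open_dist by blast
  define d where "d = min d1 (min d2 d3)"
  define s where "s = d / (norm v + norm w + 1)"
  have "d > 0"
    using d1 d2 d3 by (simp add: d_def)
  have pos: "norm v + norm w + 1 > 0"
    by (smt (verit) norm_ge_zero)
  then have "s > 0"
    using \<open>d > 0\<close> by (simp add: s_def)
  have close: "dist (x + a *\<^sub>R v + b *\<^sub>R w) x < d"
    if "0 \<le> a" "a \<le> s" "0 \<le> b" "b \<le> s" for a b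
  proof -
    have "dist (x + a *\<^sub>R v + b *\<^sub>R w) x = norm (a *\<^sub>R v + b *\<^sub>R w)"
      by (simp add: dist_norm algebra_simps)
    also have "\<dots> \<le> norm (a *\<^sub>R v) + norm (b *\<^sub>R w)"
      by (rule norm_triangle_ineq)
    also have "\<dots> = a * norm v + b * norm w"
      using that by simp
    also have "\<dots> \<le> s * norm v + s * norm w"
      using that by (intro add_mono mult_right_mono) auto
    also have "\<dots> < s * (norm v + norm w + 1)"
      using \<open>s > 0\<close> by (simp add: algebra_simps)
    also have "\<dots> = d"
      using pos by (simp add: s_def)
    finally show ?thesis .
  qed
  have inS: "x + a *\<^sub>R v + b *\<^sub>R w \<in> S"
    if "0 \<le> a" "a \<le> s" "0 \<le> b" "b \<le> s" for a b
    using close [OF that] d3 by (simp add: d_def)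
  then have inS': "x + a *\<^sub>R w + b *\<^sub>R v \<in> S"
    if "0 \<le> a" "a \<le> s" "0 \<le> b" "b \<le> s" for a b
    using inS [of b a] that by (simp add: algebra_simps)
  obtain a b where ab: "0 < a" "a < s" "0 < b" "b < s"
    and eqA: "g (x + s *\<^sub>R v + s *\<^sub>R w) - g (x + s *\<^sub>R v) - (g (x + s *\<^sub>R w) - g x)
       = s\<^sup>2 * ?A (x + a *\<^sub>R v + b *\<^sub>R w)"
    using second_difference_mean_value [OF \<open>0 < s\<close> inS g dg] by blast
  obtain a' b' where ab': "0 < a'" "a' < s" "0 < b'" "b' < s"
    and eqB: "g (x + s *\<^sub>R w + s *\<^sub>R v) - g (x + s *\<^sub>R w) - (g (x + s *\<^sub>R v) - g x)
       = s\<^sup>2 * ?B (x + a' *\<^sub>R w + b' *\<^sub>R v)"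
    using second_difference_mean_value [OF \<open>0 < s\<close> inS' g dg] by blast
  have "s\<^sup>2 * ?A (x + a *\<^sub>R v + b *\<^sub>R w) = s\<^sup>2 * ?B (x + a' *\<^sub>R w + b' *\<^sub>R v)"
    unfolding eqA [symmetric] eqB [symmetric] by (simp add: algebra_simps)
  then have "?A (x + a *\<^sub>R v + b *\<^sub>R w) = ?B (x + a' *\<^sub>R w + b' *\<^sub>R v)"
    using \<open>s > 0\<close> by simp
  moreover have "dist (?A (x + a *\<^sub>R v + b *\<^sub>R w)) (?A x) < e"
    using close [of a b] ab by (intro d1) (simp add: d_def)
  moreover have "dist (?B (x + a' *\<^sub>R w + b' *\<^sub>R v)) (?B x) < e"
    using close [of b' a'] ab' by (intro d2) (simp add: d_def algebra_simps)
  ultimately have "\<bar>?A x - ?B x\<bar> < 2 * e"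
    by (simp add: dist_real_def)
  then show False
    by (simp add: e_def)
qed

section \<open>Symmetric trilinear forms bounded on the diagonal\<close>

text \<open>When \<open>m\<close> and \<open>n\<close> are orthonormal, this writes \<open>h \<otimes> h \<otimes> k\<close> as a signed combination of cubes of unit
vectors. Let \<open>m\<close> be the direction at a third of the way, in angle, from \<open>h\<close> to \<open>k\<close>, so that \<open>h\<close> lies at
angle \<open>-\<tau>\<close> and \<open>k\<close> at angle \<open>2\<tau>\<close> from \<open>m\<close>, with \<open>C = cos \<tau>\<close> and \<open>S = sin \<tau>\<close>. The nodes \<open>m\<close>, \<open>p\<close>,
\<open>q\<close> lie at the angles \<open>0\<close>, \<open>\<pi> / 3\<close> and \<open>2\<pi> / 3\<close>. The absolute weights are the squares
\<open>(1 + 2 cos \<theta>)\<^sup>2\<close> at \<open>\<theta> = 2\<tau>\<close>, \<open>2\<tau> + 2\<pi> / 3\<close> and \<open>2\<tau> + 4\<pi> / 3\<close>; they always add up to \<open>9\<close>, which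
is what makes the bound below sharp. It is the interpolation formula behind the Bernstein-Szego
inequality for the trigonometric polynomial that a cubic form induces on the circle.\<close>

lemma cubic_node_identity:
  fixes m n :: "'a::real_vector" and A :: "'a \<Rightarrow> 'a \<Rightarrow> 'a \<Rightarrow> real" and C S :: real
  assumes lin: "\<And>u v. linear (A u v)"
    and sym12: "\<And>u v w. A u v w = A v u w"
    and sym23: "\<And>u v w. A u v w = A u w v"
    and CS: "C\<^sup>2 + S\<^sup>2 = 1"
  defines "h \<equiv> C *\<^sub>R m - S *\<^sub>R n" and "k \<equiv> (C\<^sup>2 - S\<^sup>2) *\<^sub>R m + (2 * S * C) *\<^sub>R n"
    and "p \<equiv> (1 / 2) *\<^sub>R m + (sqrt 3 / 2) *\<^sub>R n" and "q \<equiv> (- 1 / 2) *\<^sub>R m + (sqrt 3 / 2) *\<^sub>R n"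
  shows "9 * A h h k = (1 + 2 * (C\<^sup>2 - S\<^sup>2))\<^sup>2 * A m m m
     - (1 - (C\<^sup>2 - S\<^sup>2) - sqrt 3 * (2 * S * C))\<^sup>2 * A p p p
     + (1 - (C\<^sup>2 - S\<^sup>2) + sqrt 3 * (2 * S * C))\<^sup>2 * A q q q"
proof -
  have expand: "A (x *\<^sub>R m + y *\<^sub>R n) (x *\<^sub>R m + y *\<^sub>R n) (x' *\<^sub>R m + y' *\<^sub>R n)
      = x\<^sup>2 * x' * A m m m + (x\<^sup>2 * y' + 2 * x * y * x') * A m m n
        + (2 * x * y * y' + y\<^sup>2 * x') * A m n n + y\<^sup>2 * y' * A n n n" for x y x' y'
  proof -
    have 3: "A u v (x *\<^sub>R w + y *\<^sub>R z) = x * A u v w + y * A u v z" for u v w z x y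
      using lin [of u v] by (simp add: linear_add linear_scale)
    have 2: "A u (x *\<^sub>R w + y *\<^sub>R z) v = x * A u w v + y * A u z v" for u v w z x y
      by (simp only: sym23 [of u _ v] 3)
    have 1: "A (x *\<^sub>R w + y *\<^sub>R z) u v = x * A w u v + y * A z u v" for u v w z x y
      by (simp only: sym12 [of _ u v] 2)
    have "A m n m = A m m n" "A n m m = A m m n" "A n m n = A m n n" "A n n m = A m n n"
      by (metis sym12 sym23)+
    then show ?thesis
      by (simp add: 1 2 3 algebra_simps power2_eq_square)
  qed
  have h: "h = C *\<^sub>R m + (- S) *\<^sub>R n"
    by (simp add: h_def)
  define r where "r = sqrt (3::real)"
  have r: "r\<^sup>2 = 3"
    by (simp add: r_def)
  \<comment> \<open>In terms of the double angle, \<open>D = cos 2\<tau>\<close> and \<open>E = sin 2\<tau>\<close>, all coefficients are quadratic.\<close>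
  define D where "D = C\<^sup>2 - S\<^sup>2"
  define E where "E = 2 * S * C"
  have C2: "C\<^sup>2 = (1 + D) / 2" and S2: "S\<^sup>2 = (1 - D) / 2"
    using CS by (simp_all add: D_def field_simps)
  have E2: "E\<^sup>2 = 1 - D\<^sup>2"
  proof -
    have "E\<^sup>2 = 4 * S\<^sup>2 * C\<^sup>2"
      by (simp add: E_def power_mult_distrib)
    then show ?thesis
      unfolding C2 S2 by (simp add: field_simps power2_eq_square)
  qed
  have r3: "r * r = 3" "r * (r * a) = 3 * a" for a
    using r by (simp_all add: power2_eq_square flip: mult.assoc)
  have E3: "E * E = 1 - D * D" "E * (E * a) = (1 - D * D) * a" for a
    using E2 by (simp_all add: power2_eq_square flip: mult.assoc)
  have Ah: "A h h k = (1 + D) / 2 * D * A m m m + ((1 + D) / 2 * E - E * D) * A m m n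
      + (- E * E + (1 - D) / 2 * D) * A m n n + (1 - D) / 2 * E * A n n n"
  proof -
    have CS': "2 * C * - S = - E" "(- S)\<^sup>2 = (1 - D) / 2"
      by (simp_all add: E_def S2)
    show ?thesis
      unfolding h k_def D_def [symmetric] E_def [symmetric]
      unfolding expand unfolding CS' unfolding C2 by (simp add: algebra_simps)
  qed
  have Ap: "A p p p = (1 / 8) * A m m m + (3 * r / 8) * A m m n + (9 / 8) * A m n n + (3 * r / 8) * A n n n"
    unfolding p_def r_def [symmetric] expand using r by (simp add: power2_eq_square algebra_simps r3)
  have Aq: "A q q q = - (1 / 8) * A m m m + (3 * r / 8) * A m m n - (9 / 8) * A m n n + (3 * r / 8) * A n n n"
    unfolding q_def r_def [symmetric] expand using r by (simp add: power2_eq_square algebra_simps r3)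
  show ?thesis
    unfolding D_def [symmetric] E_def [symmetric] r_def [symmetric] Ah Ap Aq
    by (simp add: power2_eq_square algebra_simps r3 E3 add_divide_distrib diff_divide_distrib)
qed

text \<open>Unless \<open>k\<close> is a multiple of \<open>h\<close>, the two span a Euclidean plane, where the identity above expresses \<open>A h h k\<close> as an
average of diagonal values, up to signs.\<close>

lemma trilinear_unit_bound:
  fixes A :: "'a::real_vector \<Rightarrow> 'a \<Rightarrow> 'a \<Rightarrow> real" and B :: "'a \<Rightarrow> 'a \<Rightarrow> real"
  assumes linA: "\<And>u v. linear (A u v)"
    and sym12: "\<And>u v w. A u v w = A v u w"
    and sym23: "\<And>u v w. A u v w = A u w v"
    and linB: "\<And>u. linear (B u)" and symB: "\<And>u v. B u v = B v u"
    and posB: "\<And>u. u \<noteq> 0 \<Longrightarrow> B u u > 0"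
    and diag: "\<And>u. B u u = 1 \<Longrightarrow> \<bar>A u u u\<bar> \<le> c"
    and unit: "B h h = 1" "B k k = 1"
  shows "\<bar>A h h k\<bar> \<le> c"
proof -
  have B2: "B u (x *\<^sub>R w + y *\<^sub>R z) = x * B u w + y * B u z" for u w z x y
    using linB [of u] by (simp add: linear_add linear_scale)
  have B1: "B (x *\<^sub>R w + y *\<^sub>R z) u = x * B w u + y * B z u" for u w z x y
    by (simp only: symB [of _ u] B2)
  define a where "a = B h k"
  have kah: "B (1 *\<^sub>R k + (- a) *\<^sub>R h) (1 *\<^sub>R k + (- a) *\<^sub>R h) = 1 - a\<^sup>2"
    using unit symB [of k h] by (simp only: B1 B2) (simp add: a_def power2_eq_square)
  show ?thesis
  proof (cases "k = a *\<^sub>R h")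
    case True
    then have "a\<^sup>2 = 1"
      using kah linear_0 [OF linB] by simp
    then have "\<bar>a\<bar> = 1"
      by (auto simp: power2_eq_1_iff)
    moreover have "A h h k = a * A h h h"
      using linA [of h h] by (simp add: True linear_scale)
    ultimately show ?thesis
      using diag [OF unit(1)] by (simp add: abs_mult)
  next
    case False
    then have "1 - a\<^sup>2 > 0"
      unfolding kah [symmetric] by (intro posB) simp
    define s where "s = sqrt (1 - a\<^sup>2)"
    have s: "s > 0" "s\<^sup>2 = 1 - a\<^sup>2"
      using \<open>1 - a\<^sup>2 > 0\<close> by (simp_all add: s_def)
    define e where "e = (1 / s) *\<^sub>R (1 *\<^sub>R k + (- a) *\<^sub>R h)"
    have k: "k = a *\<^sub>R h + s *\<^sub>R e"
      using s by (simp add: e_def)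
    have e': "e = (1 / s) *\<^sub>R k + (- a / s) *\<^sub>R h"
      by (simp add: e_def scaleR_diff_right)
    have ee: "B e e = 1"
    proof -
      have "B e e = (1 / s)\<^sup>2 * (1 - a\<^sup>2)"
        unfolding e' using unit symB [of k h]
        by (simp only: B1 B2) (simp add: a_def power2_eq_square algebra_simps diff_divide_distrib)
      then show ?thesis
        unfolding s(2) [symmetric] using s(1) by (simp add: power_divide)
    qed
    have he: "B h e = 0" "B e h = 0"
      using unit symB [of e h] unfolding e' by (simp_all only: B1 B2) (simp_all add: a_def)
    \<comment> \<open>The angle from \<open>h\<close> to \<open>k\<close> is \<open>3\<tau>\<close>; then \<open>m\<close> is \<open>h\<close> rotated by \<open>\<tau>\<close>.\<close>
    obtain \<tau> where \<tau>: "a = cos (3 * \<tau>)" "s = sin (3 * \<tau>)"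
    proof -
      obtain t where "a = cos t" "s = sin t"
        using sincos_total_2pi [of a s] s by auto
      then show thesis
        using that [of "t / 3"] by simp
    qed
    define C where "C = cos \<tau>"
    define S where "S = sin \<tau>"
    define D where "D = C\<^sup>2 - S\<^sup>2"
    define E where "E = 2 * S * C"
    have CS: "C\<^sup>2 + S\<^sup>2 = 1"
      by (simp add: C_def S_def)
    define m where "m = C *\<^sub>R h + S *\<^sub>R e"
    define n where "n = (- S) *\<^sub>R h + C *\<^sub>R e"
    have orth: "B m m = 1" "B n n = 1" "B m n = 0" "B n m = 0"
      unfolding m_def n_def using CS unit ee he
      by (simp_all only: B1 B2) (simp_all add: power2_eq_square)
    have h_mn: "h = C *\<^sub>R m - S *\<^sub>R n"
    proof -
      have "C *\<^sub>R m - S *\<^sub>R n = (C\<^sup>2 + S\<^sup>2) *\<^sub>R h"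
        by (simp add: m_def n_def algebra_simps power2_eq_square)
      then show ?thesis
        using CS by simp
    qed
    have D: "D = cos (2 * \<tau>)" and E: "E = sin (2 * \<tau>)"
      by (simp_all add: D_def E_def C_def S_def cos_double sin_double)
    have as: "a = D * C - E * S" "s = E * C + D * S"
      unfolding \<tau> D E C_def S_def by (simp_all flip: cos_add sin_add)
    have k_mn: "k = (C\<^sup>2 - S\<^sup>2) *\<^sub>R m + (2 * S * C) *\<^sub>R n"
      unfolding D_def [symmetric] E_def [symmetric] k as m_def n_def by (simp add: algebra_simps)
    define p where "p = (1 / 2) *\<^sub>R m + (sqrt 3 / 2) *\<^sub>R n"
    define q where "q = (- 1 / 2) *\<^sub>R m + (sqrt 3 / 2) *\<^sub>R n"
    have "B p p = 1" "B q q = 1"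
      unfolding p_def q_def using orth by (simp_all only: B1 B2) simp_all
    then have pq: "\<bar>A p p p\<bar> \<le> c" "\<bar>A q q q\<bar> \<le> c"
      by (auto intro: diag)
    have mm: "\<bar>A m m m\<bar> \<le> c"
      using orth by (intro diag)
    let ?u = "(1 + 2 * D)\<^sup>2" and ?v = "(1 - D - sqrt 3 * E)\<^sup>2" and ?w = "(1 - D + sqrt 3 * E)\<^sup>2"
    have "9 * A h h k = ?u * A m m m - ?v * A p p p + ?w * A q q q"
      using cubic_node_identity [of A C S m n, OF linA sym12 sym23 CS]
      by (simp only: D_def E_def p_def q_def flip: h_mn k_mn)
    also have "\<bar>\<dots>\<bar> \<le> ?u * \<bar>A m m m\<bar> + ?v * \<bar>A p p p\<bar> + ?w * \<bar>A q q q\<bar>"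
    proof -
      have "\<bar>x - y + z\<bar> \<le> \<bar>x\<bar> + \<bar>y\<bar> + \<bar>z\<bar>" for x y z :: real
        by linarith
      from this [of "?u * A m m m" "?v * A p p p" "?w * A q q q"] show ?thesis
        by (simp only: abs_mult abs_power2)
    qed
    also have "\<dots> \<le> ?u * c + ?v * c + ?w * c"
      using mm pq by (intro add_mono mult_left_mono) auto
    also have "\<dots> = (3 + 6 * (D\<^sup>2 + E\<^sup>2)) * c"
      by (simp add: power2_eq_square algebra_simps)
    also have "\<dots> = 9 * c"
      by (simp add: D E)
    finally show ?thesis
      by simp
  qed
qed

lemma trilinear_mixed_bound:
  fixes A :: "'a::real_vector \<Rightarrow> 'a \<Rightarrow> 'a \<Rightarrow> real" and B :: "'a \<Rightarrow> 'a \<Rightarrow> real"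
  assumes linA: "\<And>u v. linear (A u v)"
    and sym12: "\<And>u v w. A u v w = A v u w"
    and sym23: "\<And>u v w. A u v w = A u w v"
    and linB: "\<And>u. linear (B u)" and symB: "\<And>u v. B u v = B v u"
    and posB: "\<And>u. u \<noteq> 0 \<Longrightarrow> B u u > 0"
    and diag: "\<And>u. \<bar>A u u u\<bar> \<le> c * sqrt (B u u) ^ 3"
  shows "\<bar>A h h k\<bar> \<le> c * B h h * sqrt (B k k)"
proof (cases "h = 0 \<or> k = 0")
  case True
  have "A u v 0 = 0" "B u 0 = 0" for u v
    using linear_0 [OF linA] linear_0 [OF linB] by auto
  with True show ?thesis
    using sym23 [of h h k] by auto
next
  case False
  have A3: "A u v (x *\<^sub>R w) = x * A u v w" for u v w x
    using linA [of u v] by (simp add: linear_scale)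
  have A2: "A u (x *\<^sub>R w) v = x * A u w v" for u v w x
    by (simp only: sym23 [of u _ v] A3)
  have A1: "A (x *\<^sub>R w) u v = x * A w u v" for u v w x
    by (simp only: sym12 [of _ u v] A2)
  have B2: "B u (x *\<^sub>R w) = x * B u w" for u w x
    using linB [of u] by (simp add: linear_scale)
  have B1: "B (x *\<^sub>R w) u = x * B w u" for u w x
    by (simp only: symB [of _ u] B2)
  define a where "a = sqrt (B h h)"
  define b where "b = sqrt (B k k)"
  have a: "a > 0" "B h h = a\<^sup>2" and b: "b > 0" "B k k = b\<^sup>2"
    using posB [of h] posB [of k] False by (simp_all add: a_def b_def)
  have "\<bar>A ((1 / a) *\<^sub>R h) ((1 / a) *\<^sub>R h) ((1 / b) *\<^sub>R k)\<bar> \<le> c"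
  proof (rule trilinear_unit_bound [OF linA sym12 sym23 linB symB posB])
    show "\<bar>A u u u\<bar> \<le> c" if "B u u = 1" for u
      using diag [of u] that by simp
    show "B ((1 / a) *\<^sub>R h) ((1 / a) *\<^sub>R h) = 1" "B ((1 / b) *\<^sub>R k) ((1 / b) *\<^sub>R k) = 1"
      using a b by (simp_all add: B1 B2 power2_eq_square)
  qed
  then have "\<bar>A h h k\<bar> / (b * (a * a)) \<le> c"
    using a b by (simp add: A1 A2 A3 abs_mult mult.commute)
  then show ?thesis
    using a b by (simp add: field_simps power2_eq_square flip: b_def)
qed

section \<open>Self-concordant functions and their local norms\<close>

lemma second_order_lower_bound:
  fixes g g' g'' :: "real \<Rightarrow> real"
  assumes "0 \<le> t"
    and g: "\<And>s. 0 \<le> s \<Longrightarrow> s \<le> t \<Longrightarrow> (g has_real_derivative g' s) (at s)"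
    and g': "\<And>s. 0 \<le> s \<Longrightarrow> s \<le> t \<Longrightarrow> (g' has_real_derivative g'' s) (at s)"
    and nonneg: "\<And>s. 0 \<le> s \<Longrightarrow> s \<le> t \<Longrightarrow> 0 \<le> g'' s"
  shows "g 0 + t * g' 0 \<le> g t"
proof -
  have mono: "g' 0 \<le> g' s" if "0 \<le> s" "s \<le> t" for s
  proof (rule DERIV_nonneg_imp_nondecreasing [OF that(1)])
    fix r assume "0 \<le> r" "r \<le> s"
    then show "\<exists>y. (g' has_real_derivative y) (at r) \<and> 0 \<le> y"
      using g' [of r] nonneg [of r] that by (intro exI [of _ "g'' r"]) simp
  qed
  have "g 0 - 0 * g' 0 \<le> g t - t * g' 0"
  proof (rule DERIV_nonneg_imp_nondecreasing [OF \<open>0 \<le> t\<close>])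
    fix s assume s: "0 \<le> s" "s \<le> t"
    have "((\<lambda>s. g s - s * g' 0) has_real_derivative g' s - g' 0) (at s)"
      by (rule DERIV_diff [OF g [OF s]]) (auto intro!: derivative_eq_intros)
    then show "\<exists>y. ((\<lambda>s. g s - s * g' 0) has_real_derivative y) (at s) \<and> 0 \<le> y"
      using mono [OF s] by force
  qed
  then show ?thesis by simp
qed

text \<open>The hypothesis on the derivative of \<open>q\<close> says exactly that \<open>q\<close> to the power \<open>- 1 / 2\<close> has a derivative
of absolute value at most one. Along a line, \<open>q\<close> will be the second derivative of a self-concordant
function.\<close>

lemma inverse_sqrt_lipschitz:
  fixes q q' :: "real \<Rightarrow> real"
  assumes "0 \<le> t"
    and q: "\<And>s. 0 \<le> s \<Longrightarrow> s \<le> t \<Longrightarrow> (q has_real_derivative q' s) (at s)"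
    and pos: "\<And>s. 0 \<le> s \<Longrightarrow> s \<le> t \<Longrightarrow> 0 < q s"
    and bound: "\<And>s. 0 \<le> s \<Longrightarrow> s \<le> t \<Longrightarrow> \<bar>q' s\<bar> \<le> 2 * sqrt (q s) ^ 3"
  shows "\<bar>1 / sqrt (q t) - 1 / sqrt (q 0)\<bar> \<le> t"
proof -
  let ?p = "\<lambda>s. 1 / sqrt (q s)"
  define p' where "p' s = - (q' s / (2 * sqrt (q s) ^ 3))" for s
  have p: "(?p has_real_derivative p' s) (at s)" if "0 \<le> s" "s \<le> t" for s
  proof -
    have "((\<lambda>s. sqrt (q s)) has_real_derivative inverse (sqrt (q s)) / 2 * q' s) (at s)"
      using pos [OF that] DERIV_chain2 [OF DERIV_real_sqrt q [OF that]] by simp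
    then have "((\<lambda>s. inverse (sqrt (q s))) has_real_derivative
        - (inverse (sqrt (q s)) / 2 * q' s * inverse (sqrt (q s) ^ Suc (Suc 0)))) (at s)"
      by (rule DERIV_inverse_fun) (use pos [OF that] in simp)
    moreover have "- (inverse z / 2 * y * inverse (z ^ Suc (Suc 0))) = - (y / (2 * z ^ 3))"
      for y z :: real
      by (simp add: inverse_eq_divide power3_eq_cube)
    ultimately show ?thesis
      unfolding p'_def by (simp only: inverse_eq_divide)
  qed
  have p': "\<bar>p' s\<bar> \<le> 1" if "0 \<le> s" "s \<le> t" for s
    using bound [OF that] pos [OF that] by (simp add: p'_def abs_mult)
  have "?p 0 + 0 \<le> ?p t + t"
  proof (rule DERIV_nonneg_imp_nondecreasing [OF \<open>0 \<le> t\<close>])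
    fix s assume s: "0 \<le> s" "s \<le> t"
    have "((\<lambda>s. ?p s + s) has_real_derivative p' s + 1) (at s)"
      by (rule DERIV_add [OF p [OF s] DERIV_ident])
    then show "\<exists>y. ((\<lambda>s. ?p s + s) has_real_derivative y) (at s) \<and> 0 \<le> y"
      using p' [OF s] by (intro exI conjI) auto
  qed
  moreover have "0 - ?p 0 \<le> t - ?p t"
  proof (rule DERIV_nonneg_imp_nondecreasing [OF \<open>0 \<le> t\<close>])
    fix s assume s: "0 \<le> s" "s \<le> t"
    have "((\<lambda>s. s - ?p s) has_real_derivative 1 - p' s) (at s)"
      by (rule DERIV_diff [OF DERIV_ident p [OF s]])
    then show "\<exists>y. ((\<lambda>s. s - ?p s) has_real_derivative y) (at s) \<and> 0 \<le> y"
      using p' [OF s] by (intro exI conjI) auto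
  qed
  ultimately show ?thesis
    by (simp add: abs_le_iff)
qed

lemma sqrt_growth_bounds:
  fixes q q' :: "real \<Rightarrow> real"
  assumes "0 \<le> t"
    and q: "\<And>s. 0 \<le> s \<Longrightarrow> s \<le> t \<Longrightarrow> (q has_real_derivative q' s) (at s)"
    and pos: "\<And>s. 0 \<le> s \<Longrightarrow> s \<le> t \<Longrightarrow> 0 < q s"
    and bound: "\<And>s. 0 \<le> s \<Longrightarrow> s \<le> t \<Longrightarrow> \<bar>q' s\<bar> \<le> 2 * sqrt (q s) ^ 3"
  shows "sqrt (q 0) / (1 + t * sqrt (q 0)) \<le> sqrt (q t)"
    and "t * sqrt (q 0) < 1 \<Longrightarrow> sqrt (q t) \<le> sqrt (q 0) / (1 - t * sqrt (q 0))"
proof -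
  define a where "a = sqrt (q 0)"
  define b where "b = sqrt (q t)"
  have ab: "a > 0" "b > 0"
    using pos [of 0] pos [of t] \<open>0 \<le> t\<close> by (simp_all add: a_def b_def)
  have *: "\<bar>1 / b - 1 / a\<bar> \<le> t"
    using inverse_sqrt_lipschitz [OF assms] by (simp add: a_def b_def)
  have "a \<le> b * (1 + t * a)"
  proof -
    have "(1 / b) * (a * b) \<le> (1 / a + t) * (a * b)"
      using * ab by (intro mult_right_mono) auto
    also have "(1 / a + t) * (a * b) = b * (1 + t * a)"
      using ab by (simp add: distrib_right) (simp add: algebra_simps)
    finally show ?thesis
      using ab by simp
  qed
  then show "sqrt (q 0) / (1 + t * sqrt (q 0)) \<le> sqrt (q t)"
    using ab \<open>0 \<le> t\<close> unfolding a_def [symmetric] b_def [symmetric]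
    by (simp add: pos_divide_le_eq add_pos_nonneg)
  have "b * (1 - t * a) \<le> a"
  proof -
    have "(1 / a - t) * (a * b) \<le> (1 / b) * (a * b)"
      using * ab by (intro mult_right_mono) auto
    also have "(1 / a - t) * (a * b) = b * (1 - t * a)"
      using ab by (simp add: left_diff_distrib) (simp add: algebra_simps)
    finally show ?thesis
      using ab by simp
  qed
  then show "sqrt (q t) \<le> sqrt (q 0) / (1 - t * sqrt (q 0))" if "t * sqrt (q 0) < 1"
    using that unfolding a_def [symmetric] b_def [symmetric]
    by (simp add: pos_le_divide_eq)
qed

text \<open>Only directional derivatives are used below: \<open>D1 x u\<close>, \<open>D2 x u v\<close> and \<open>D3 x u v w\<close> are the derivatives
of order one to three at \<open>x\<close> as multilinear forms, with \<open>D2 x\<close> the inner product of the local norm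
at \<open>x\<close>. Gradient and Hessian are related to them once, in \<open>gradient_inner\<close> and \<open>hessian_inner\<close>.\<close>

locale self_concordant_function =
  fixes f :: "real^'n \<Rightarrow> ereal"
  assumes sc: "standard_self_concordant f"
    and pd: "\<And>x. x \<in> edom f \<Longrightarrow> positive_definite (hessian (real_part f) x)"
begin

abbreviation "\<Omega> \<equiv> edom f"
abbreviation "\<phi> \<equiv> real_part f"

definition D1 where "D1 x u = dir_deriv \<phi> u x"
definition D2 where "D2 x u v = dir_deriv (dir_deriv \<phi> u) v x"
definition D3 where "D3 x u v w = dir_deriv (dir_deriv (dir_deriv \<phi> u) v) w x"
definition local_norm where "local_norm x u = sqrt (D2 x u u)"

lemma open_dom: "open \<Omega>" and convex_dom: "convex \<Omega>"
  using sc convex_on_imp_convex unfolding standard_self_concordant_def by blast+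

lemma three_times_differentiable: "cont_differentiable_on (Suc (Suc (Suc 0))) \<phi> \<Omega>"
  using sc by (simp add: standard_self_concordant_def numeral_3_eq_3)

lemma twice_differentiable: "cont_differentiable_on (Suc (Suc 0)) \<phi> \<Omega>"
  by (rule cont_differentiable_on_Suc_imp [OF three_times_differentiable])

lemma differentiable:
  assumes "x \<in> \<Omega>"
  shows "\<phi> differentiable (at x)" "dir_deriv \<phi> u differentiable (at x)"
    "dir_deriv (dir_deriv \<phi> u) v differentiable (at x)"
  using three_times_differentiable assms unfolding cont_differentiable_on_Suc_dir_deriv by blast+

lemma line_derivatives:
  assumes "x + t *\<^sub>R u \<in> \<Omega>"
  shows "((\<lambda>t. \<phi> (x + t *\<^sub>R u)) has_real_derivative D1 (x + t *\<^sub>R u) u) (at t)"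
    and "((\<lambda>t. D1 (x + t *\<^sub>R u) v) has_real_derivative D2 (x + t *\<^sub>R u) v u) (at t)"
    and "((\<lambda>t. D2 (x + t *\<^sub>R u) v w) has_real_derivative D3 (x + t *\<^sub>R u) v w u) (at t)"
  unfolding D1_def D2_def D3_def
  using assms by (intro has_real_derivative_along_line differentiable; simp)+

lemma linear_D1: "x \<in> \<Omega> \<Longrightarrow> linear (D1 x)"
  using linear_dir_deriv [OF differentiable(1)] by (simp add: D1_def [abs_def])

lemma linear_D2: "x \<in> \<Omega> \<Longrightarrow> linear (D2 x u)"
  using linear_dir_deriv [OF differentiable(2)] by (simp add: D2_def [abs_def])

lemma linear_D3: "x \<in> \<Omega> \<Longrightarrow> linear (D3 x u v)"
  using linear_dir_deriv [OF differentiable(3)] by (simp add: D3_def [abs_def])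

lemma D2_commute: "x \<in> \<Omega> \<Longrightarrow> D2 x u v = D2 x v u"
  unfolding D2_def using open_dom twice_differentiable by (intro dir_deriv_commute) (simp_all add: numeral_2_eq_2)

lemma D3_commute_left:
  assumes "x \<in> \<Omega>"
  shows "D3 x u v w = D3 x v u w"
  unfolding D3_def
  using dir_deriv_cong_open [OF open_dom assms _ differentiable(3) [OF assms]] D2_commute
  unfolding D2_def by blast

lemma D3_commute_right:
  assumes "x \<in> \<Omega>"
  shows "D3 x u v w = D3 x u w v"
  unfolding D3_def
proof (rule dir_deriv_commute [OF open_dom assms])
  show "cont_differentiable_on 2 (dir_deriv \<phi> u) \<Omega>"
    using three_times_differentiable unfolding numeral_2_eq_2 by (subst (asm) cont_differentiable_on_Suc_dir_deriv) blast
qed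

lemma gradient_inner:
  assumes "x \<in> \<Omega>"
  shows "v \<bullet> gradient \<phi> x = D1 x v"
proof -
  define G where "G = (\<Sum>i\<in>Basis. D1 x i *\<^sub>R i)"
  have G: "v \<bullet> G = D1 x v" for v
  proof -
    have "D1 x v = D1 x (\<Sum>i\<in>Basis. (v \<bullet> i) *\<^sub>R i)"
      by (simp add: euclidean_representation)
    also have "\<dots> = (\<Sum>i\<in>Basis. (v \<bullet> i) * D1 x i)"
      using linear_D1 [OF assms] by (simp add: linear_sum linear_scale)
    also have "\<dots> = v \<bullet> G"
      by (simp add: G_def inner_sum_right mult.commute)
    finally show ?thesis by simp
  qed
  have "GDERIV \<phi> x :> G"
    unfolding gderiv_def G using has_derivative_dir_deriv [OF differentiable(1) [OF assms]]
    by (simp add: D1_def)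
  moreover have "G' = G" if "GDERIV \<phi> x :> G'" for G'
  proof -
    have "(\<lambda>h. h \<bullet> G') = (\<lambda>h. h \<bullet> G)"
      using that \<open>GDERIV \<phi> x :> G\<close> unfolding gderiv_def by (rule has_derivative_unique)
    then show ?thesis
      by (metis vector_eq_ldot)
  qed
  ultimately have "gradient \<phi> x = G"
    unfolding gradient_def by (rule the_equality)
  then show ?thesis
    by (simp add: G)
qed

lemma hessian_inner:
  assumes "x \<in> \<Omega>"
  shows "u \<bullet> (hessian \<phi> x *v v) = D2 x u v"
proof -
  have comp: "((\<lambda>y. gradient \<phi> y \<bullet> i) has_derivative (\<lambda>v. D2 x i v)) (at x)" for i
  proof (rule has_derivative_transform_within_open [OF _ open_dom assms])
    show "(dir_deriv \<phi> i has_derivative (\<lambda>v. D2 x i v)) (at x)"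
      unfolding D2_def by (rule has_derivative_dir_deriv [OF differentiable(2) [OF assms]])
    show "dir_deriv \<phi> i y = gradient \<phi> y \<bullet> i" if "y \<in> \<Omega>" for y
      using gradient_inner [OF that] by (simp add: D1_def inner_commute)
  qed
  define H where "H v = (\<Sum>i\<in>Basis. D2 x i v *\<^sub>R i)" for v
  have H: "H v \<bullet> i = D2 x i v" if "i \<in> Basis" for i v
    using that by (simp add: H_def inner_sum_left_Basis)
  have "(gradient \<phi> has_derivative H) (at x)"
    using comp by (subst has_derivative_componentwise_within) (simp add: H)
  then have "(gradient \<phi> has_derivative (\<lambda>v. hessian \<phi> x *v v)) (at x)"
    unfolding hessian_def by (subst jacobian_works [symmetric]) (auto simp: differentiable_def)
  then have "hessian \<phi> x *v v = H v"
    using \<open>(gradient \<phi> has_derivative H) (at x)\<close> has_derivative_unique by metis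
  moreover have "((\<lambda>y. gradient \<phi> y \<bullet> u) has_derivative (\<lambda>v. H v \<bullet> u)) (at x)"
    using \<open>(gradient \<phi> has_derivative H) (at x)\<close> by (rule has_derivative_inner_left)
  then have "(\<lambda>v. H v \<bullet> u) = D2 x u"
    using comp [of u] by (rule has_derivative_unique)
  ultimately show ?thesis
    by (metis inner_commute)
qed

lemma D2_pos: "x \<in> \<Omega> \<Longrightarrow> u \<noteq> 0 \<Longrightarrow> D2 x u u > 0"
  using pd hessian_inner by (metis positive_definite_def)

lemma D2_nonneg: "x \<in> \<Omega> \<Longrightarrow> D2 x u u \<ge> 0"
  using D2_pos [of x u] linear_0 [OF linear_D2, of x u] by (cases "u = 0") auto

lemma local_norm_nonneg [simp]: "x \<in> \<Omega> \<Longrightarrow> local_norm x u \<ge> 0"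
  by (simp add: local_norm_def D2_nonneg)

lemma local_norm_square: "x \<in> \<Omega> \<Longrightarrow> (local_norm x u)\<^sup>2 = D2 x u u"
  by (simp add: local_norm_def D2_nonneg)

lemma D3_diagonal_bound:
  assumes "x \<in> \<Omega>"
  shows "\<bar>D3 x u u u\<bar> \<le> 2 * local_norm x u ^ 3"
proof -
  define \<psi> where "\<psi> t = \<phi> (x + t *\<^sub>R u)" for t
  define U where "U = (\<lambda>t. x + t *\<^sub>R u) -` \<Omega>"
  have "open U"
    unfolding U_def by (rule open_vimage [OF open_dom]) (auto intro!: continuous_intros)
  have "0 \<in> U"
    using assms by (simp add: U_def)
  have d1: "deriv \<psi> t = D1 (x + t *\<^sub>R u) u" if "t \<in> U" for t
    unfolding \<psi>_def using that by (intro DERIV_imp_deriv line_derivatives) (simp add: U_def)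
  have d2: "deriv (deriv \<psi>) t = D2 (x + t *\<^sub>R u) u u" if "t \<in> U" for t
  proof (rule DERIV_imp_deriv)
    have "((\<lambda>t. D1 (x + t *\<^sub>R u) u) has_real_derivative D2 (x + t *\<^sub>R u) u u) (at t)"
      using that by (intro line_derivatives) (simp add: U_def)
    then show "(deriv \<psi> has_real_derivative D2 (x + t *\<^sub>R u) u u) (at t)"
      using \<open>open U\<close> that by (rule has_field_derivative_transform_within_open) (simp add: d1)
  qed
  have d3: "deriv (deriv (deriv \<psi>)) 0 = D3 x u u u"
  proof (rule DERIV_imp_deriv)
    have "((\<lambda>t. D2 (x + t *\<^sub>R u) u u) has_real_derivative D3 (x + 0 *\<^sub>R u) u u u) (at 0)"
      using assms by (intro line_derivatives) simp
    then have "((\<lambda>t. D2 (x + t *\<^sub>R u) u u) has_real_derivative D3 x u u u) (at 0)"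
      by simp
    then show "(deriv (deriv \<psi>) has_real_derivative D3 x u u u) (at 0)"
      using \<open>open U\<close> \<open>0 \<in> U\<close> by (rule has_field_derivative_transform_within_open) (simp add: d2)
  qed
  have "\<bar>(deriv ^^ 3) \<psi> 0\<bar> \<le> 2 * ((deriv ^^ 2) \<psi> 0) powr (3 / 2)"
    using sc assms unfolding standard_self_concordant_def Let_def \<psi>_def by blast
  then have "\<bar>D3 x u u u\<bar> \<le> 2 * (D2 x u u) powr (3 / 2)"
    using d3 d2 [OF \<open>0 \<in> U\<close>] by (simp add: numeral_3_eq_3 numeral_2_eq_2)
  also have "(D2 x u u) powr (3 / 2) = local_norm x u ^ 3"
  proof -
    have "(D2 x u u) powr (3 / 2) = ((D2 x u u) powr (1 / 2)) powr 3"
      by (simp add: powr_powr)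
    also have "\<dots> = local_norm x u powr (real 3)"
      using D2_nonneg [OF assms, of u] by (simp add: powr_half_sqrt local_norm_def)
    also have "\<dots> = local_norm x u ^ 3"
      using assms by (subst powr_realpow') auto
    finally show ?thesis .
  qed
  finally show ?thesis .
qed

text \<open>The form of self-concordance that Newton's method needs, with two equal directions and one free.\<close>

lemma D3_bound:
  assumes "x \<in> \<Omega>"
  shows "\<bar>D3 x u u v\<bar> \<le> 2 * (local_norm x u)\<^sup>2 * local_norm x v"
  unfolding local_norm_square [OF assms] unfolding local_norm_def
  using linear_D3 [OF assms] D3_commute_left [OF assms] D3_commute_right [OF assms]
    linear_D2 [OF assms] D2_commute [OF assms] D2_pos [OF assms]
    D3_diagonal_bound [OF assms, unfolded local_norm_def]
  by (rule trilinear_mixed_bound)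

end

section \<open>Growth along lines and the two kinds of Newton steps\<close>

context self_concordant_function
begin

lemma segment_in_domain:
  assumes "x \<in> \<Omega>" "x + u \<in> \<Omega>" "0 \<le> t" "t \<le> 1"
  shows "x + t *\<^sub>R u \<in> \<Omega>"
proof -
  have "(1 - t) *\<^sub>R x + t *\<^sub>R (x + u) \<in> \<Omega>"
    using convex_dom assms by (simp add: convex_alt)
  then show ?thesis
    by (simp add: algebra_simps)
qed

lemma local_norm_along_line:
  assumes "0 \<le> t" and line: "\<And>s. 0 \<le> s \<Longrightarrow> s \<le> t \<Longrightarrow> x + s *\<^sub>R u \<in> \<Omega>"
  shows "local_norm x u / (1 + t * local_norm x u) \<le> local_norm (x + t *\<^sub>R u) u"
    and "t * local_norm x u < 1 \<Longrightarrow>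
      local_norm (x + t *\<^sub>R u) u \<le> local_norm x u / (1 - t * local_norm x u)"
proof -
  have "local_norm x u / (1 + t * local_norm x u) \<le> local_norm (x + t *\<^sub>R u) u \<and>
    (t * local_norm x u < 1 \<longrightarrow>
      local_norm (x + t *\<^sub>R u) u \<le> local_norm x u / (1 - t * local_norm x u))"
  proof (cases "u = 0")
    case True
    have "x \<in> \<Omega>"
      using line [of 0] \<open>0 \<le> t\<close> by simp
    then show ?thesis
      using linear_0 [OF linear_D2] by (simp add: True local_norm_def)
  next
    case False
    let ?q = "\<lambda>s. D2 (x + s *\<^sub>R u) u u"
    have q: "(?q has_real_derivative D3 (x + s *\<^sub>R u) u u u) (at s)" "0 < ?q s"
      "\<bar>D3 (x + s *\<^sub>R u) u u u\<bar> \<le> 2 * sqrt (?q s) ^ 3" if "0 \<le> s" "s \<le> t" for s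
      using line_derivatives(3) [OF line [OF that]] D2_pos [OF line [OF that] False]
        D3_diagonal_bound [OF line [OF that], of u] by (simp_all add: local_norm_def)
    show ?thesis
      using sqrt_growth_bounds [OF \<open>0 \<le> t\<close> q] by (simp add: local_norm_def)
  qed
  then show "local_norm x u / (1 + t * local_norm x u) \<le> local_norm (x + t *\<^sub>R u) u"
    and "t * local_norm x u < 1 \<Longrightarrow>
      local_norm (x + t *\<^sub>R u) u \<le> local_norm x u / (1 - t * local_norm x u)"
    by auto
qed

text \<open>Both sides agree to first order at \<open>t = 0\<close>, and the lower bound on the local norm compares their second
derivatives; likewise for the upper bound.\<close>

lemma lower_bound_along_line:
  assumes "0 \<le> t" and line: "\<And>s. 0 \<le> s \<Longrightarrow> s \<le> t \<Longrightarrow> x + s *\<^sub>R u \<in> \<Omega>"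
  shows "\<phi> x + t * D1 x u + omega (t * local_norm x u) \<le> \<phi> (x + t *\<^sub>R u)"
proof -
  define r where "r = local_norm x u"
  have "x \<in> \<Omega>"
    using line [of 0] \<open>0 \<le> t\<close> by simp
  then have "r \<ge> 0"
    by (simp add: r_def)
  let ?g = "\<lambda>s. \<phi> (x + s *\<^sub>R u) - (s * r - ln (1 + s * r))"
  let ?g' = "\<lambda>s. D1 (x + s *\<^sub>R u) u - (r - r / (1 + s * r))"
  let ?g'' = "\<lambda>s. D2 (x + s *\<^sub>R u) u u - (r / (1 + s * r))\<^sup>2"
  have "?g 0 + t * ?g' 0 \<le> ?g t"
  proof (rule second_order_lower_bound [where g'' = ?g'', OF \<open>0 \<le> t\<close>])
    fix s assume s: "0 \<le> s" "s \<le> t"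
    have pos: "1 + s * r > 0"
      using s \<open>r \<ge> 0\<close> by (simp add: add_pos_nonneg)
    have "((\<lambda>s. s * r - ln (1 + s * r)) has_real_derivative r - r / (1 + s * r)) (at s)"
      using pos by (auto intro!: derivative_eq_intros simp: divide_inverse)
    then show "(?g has_real_derivative ?g' s) (at s)"
      by (rule DERIV_diff [OF line_derivatives(1) [OF line [OF s]]])
    have "((\<lambda>s. r - r / (1 + s * r)) has_real_derivative (r / (1 + s * r))\<^sup>2) (at s)"
      using pos by (auto intro!: derivative_eq_intros simp: power2_eq_square)
    then show "(?g' has_real_derivative ?g'' s) (at s)"
      by (rule DERIV_diff [OF line_derivatives(2) [OF line [OF s]]])
    have "x + a *\<^sub>R u \<in> \<Omega>" if "0 \<le> a" "a \<le> s" for a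
      using line that s by simp
    then have "r / (1 + s * r) \<le> local_norm (x + s *\<^sub>R u) u"
      unfolding r_def using s by (intro local_norm_along_line(1)) auto
    then have "(r / (1 + s * r))\<^sup>2 \<le> (local_norm (x + s *\<^sub>R u) u)\<^sup>2"
      using pos \<open>r \<ge> 0\<close> by (intro power_mono) auto
    then show "0 \<le> ?g'' s"
      using local_norm_square [OF line [OF s], of u] by simp
  qed
  then show ?thesis
    by (simp add: omega_def flip: r_def)
qed

lemma upper_bound_along_line:
  assumes "0 \<le> t" and line: "\<And>s. 0 \<le> s \<Longrightarrow> s \<le> t \<Longrightarrow> x + s *\<^sub>R u \<in> \<Omega>"
    and small: "t * local_norm x u < 1"
  shows "\<phi> (x + t *\<^sub>R u) \<le> \<phi> x + t * D1 x u + omega_star (t * local_norm x u)"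
proof -
  define r where "r = local_norm x u"
  have "x \<in> \<Omega>"
    using line [of 0] \<open>0 \<le> t\<close> by simp
  then have "r \<ge> 0"
    by (simp add: r_def)
  let ?g = "\<lambda>s. (- (s * r) - ln (1 - s * r)) - \<phi> (x + s *\<^sub>R u)"
  let ?g' = "\<lambda>s. (r / (1 - s * r) - r) - D1 (x + s *\<^sub>R u) u"
  let ?g'' = "\<lambda>s. (r / (1 - s * r))\<^sup>2 - D2 (x + s *\<^sub>R u) u u"
  have "?g 0 + t * ?g' 0 \<le> ?g t"
  proof (rule second_order_lower_bound [where g'' = ?g'', OF \<open>0 \<le> t\<close>])
    fix s assume s: "0 \<le> s" "s \<le> t"
    have "s * r \<le> t * r"
      using s \<open>r \<ge> 0\<close> by (intro mult_right_mono)
    then have pos: "s * r < 1" "1 - s * r > 0"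
      using small by (auto simp: r_def)
    have "((\<lambda>s. - (s * r) - ln (1 - s * r)) has_real_derivative r / (1 - s * r) - r) (at s)"
      using pos by (auto intro!: derivative_eq_intros simp: divide_inverse)
    then show "(?g has_real_derivative ?g' s) (at s)"
      by (rule DERIV_diff [OF _ line_derivatives(1) [OF line [OF s]]])
    have "((\<lambda>s. r / (1 - s * r) - r) has_real_derivative (r / (1 - s * r))\<^sup>2) (at s)"
      using pos by (auto intro!: derivative_eq_intros simp: power2_eq_square)
    then show "(?g' has_real_derivative ?g'' s) (at s)"
      by (rule DERIV_diff [OF _ line_derivatives(2) [OF line [OF s]]])
    have "x + a *\<^sub>R u \<in> \<Omega>" if "0 \<le> a" "a \<le> s" for a
      using line that s by simp
    then have "local_norm (x + s *\<^sub>R u) u \<le> r / (1 - s * r)"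
      unfolding r_def using s pos(1) by (intro local_norm_along_line(2)) (auto simp: r_def)
    then have "(local_norm (x + s *\<^sub>R u) u)\<^sup>2 \<le> (r / (1 - s * r))\<^sup>2"
      using line [OF s] by (intro power_mono) auto
    then show "0 \<le> ?g'' s"
      using local_norm_square [OF line [OF s], of u] by simp
  qed
  then show ?thesis
    by (simp add: omega_star_def flip: r_def)
qed

text \<open>If the segment from \<open>x\<close> to \<open>x + u\<close> left the open domain, it would do so first at some \<open>x + T u\<close>. Before
\<open>T\<close> the upper bound keeps \<open>f\<close> below a constant \<open>M\<close>, so the points at height \<open>M\<close> lie in the epigraph, and
its closedness puts \<open>x + T u\<close> back into the domain.\<close>

lemma Dikin_ellipsoid_in_domain:
  assumes "x \<in> \<Omega>" and small: "local_norm x u < 1"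
  shows "x + u \<in> \<Omega>"
proof (rule ccontr)
  assume out: "x + u \<notin> \<Omega>"
  define A where "A = {0..1} \<inter> (\<lambda>t. x + t *\<^sub>R u) -` (- \<Omega>)"
  have "closed A"
    unfolding A_def using open_dom
    by (intro closed_Int closed_vimage continuous_intros) (auto simp: closed_Compl)
  moreover have "1 \<in> A" "bdd_below A"
    using out by (auto simp: A_def)
  ultimately have "Inf A \<in> A"
    using closed_contains_Inf [of A] by blast
  define T where "T = Inf A"
  have T: "0 \<le> T" "T \<le> 1" "x + T *\<^sub>R u \<notin> \<Omega>"
    using \<open>Inf A \<in> A\<close> by (auto simp: A_def T_def)
  have before: "x + s *\<^sub>R u \<in> \<Omega>" if "0 \<le> s" "s < T" for s
  proof (rule ccontr)
    assume "x + s *\<^sub>R u \<notin> \<Omega>"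
    then have "s \<in> A"
      using that T by (simp add: A_def)
    then have "T \<le> s"
      unfolding T_def using \<open>bdd_below A\<close> by (rule cInf_lower)
    then show False
      using that by simp
  qed
  have "T > 0"
    using T assms(1) by (cases "T = 0") auto
  define r where "r = local_norm x u"
  have r: "0 \<le> r" "r < 1"
    using assms by (simp_all add: r_def)
  define M where "M = \<phi> x + \<bar>D1 x u\<bar> - ln (1 - r)"
  have bounded: "(x + s *\<^sub>R u, M) \<in> epigraph \<Omega> \<phi>" if s: "0 \<le> s" "s < T" for s
  proof -
    have "s * r \<le> 1 * r"
      using that T r by (intro mult_right_mono) auto
    then have sr: "s * r < 1" "0 \<le> s * r" "ln (1 - r) \<le> ln (1 - s * r)"
      using r s by auto
    have "\<phi> (x + s *\<^sub>R u) \<le> \<phi> x + s * D1 x u + omega_star (s * r)"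
      unfolding r_def using s sr(1) before by (intro upper_bound_along_line) (auto simp: r_def)
    also have "s * D1 x u \<le> \<bar>D1 x u\<bar>"
    proof -
      have "s * D1 x u \<le> s * \<bar>D1 x u\<bar>"
        using s by (intro mult_left_mono) auto
      also have "\<dots> \<le> 1 * \<bar>D1 x u\<bar>"
        using s T by (intro mult_right_mono) auto
      finally show ?thesis by simp
    qed
    also have "omega_star (s * r) \<le> - ln (1 - r)"
      using sr by (simp add: omega_star_def)
    finally show ?thesis
      using before [OF s] by (simp add: mem_epigraph M_def)
  qed
  define s where "s n = T * (1 - 1 / real (Suc n))" for n
  have "(\<lambda>n. 1 / real (Suc n)) \<longlonglongrightarrow> 0"
    using LIMSEQ_inverse_real_of_nat by (simp add: inverse_eq_divide)
  then have "s \<longlonglongrightarrow> T * (1 - 0)"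
    unfolding s_def by (intro tendsto_intros)
  then have lim: "(\<lambda>n. (x + s n *\<^sub>R u, M)) \<longlonglongrightarrow> (x + T *\<^sub>R u, M)"
    by (intro tendsto_intros) simp
  have mem: "(x + s n *\<^sub>R u, M) \<in> epigraph \<Omega> \<phi>" for n
  proof (rule bounded)
    have "0 < 1 / real (Suc n)" "1 / real (Suc n) \<le> 1"
      by simp_all
    then show "0 \<le> s n" "s n < T"
      unfolding s_def using \<open>T > 0\<close> by (simp_all del: of_nat_Suc)
  qed
  have "closed (epigraph \<Omega> \<phi>)"
    using sc by (simp add: standard_self_concordant_def)
  then have "(x + T *\<^sub>R u, M) \<in> epigraph \<Omega> \<phi>"
    using mem lim by (rule closed_sequentially)
  then show False
    using T by (simp add: mem_epigraph)
qed

lemma D2_Cauchy_Schwarz: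
  assumes "x \<in> \<Omega>"
  shows "D2 x u v \<le> local_norm x u * local_norm x v"
proof (cases "u = 0 \<or> v = 0")
  case True
  then show ?thesis
    using linear_0 [OF linear_D2 [OF assms]] D2_commute [OF assms, of u v]
    by (auto simp: local_norm_def)
next
  case False
  define a where "a = local_norm x u"
  define b where "b = local_norm x v"
  have ab: "a > 0" "b > 0"
    using False D2_pos [OF assms] by (auto simp: a_def b_def local_norm_def)
  have sq: "D2 x u u = a\<^sup>2" "D2 x v v = b\<^sup>2"
    using assms by (simp_all add: a_def b_def local_norm_square)
  have right: "D2 x w (s *\<^sub>R u - t *\<^sub>R v) = s * D2 x w u - t * D2 x w v" for s t w
    using linear_D2 [OF assms, of w] by (simp add: linear_diff linear_scale)
  have left: "D2 x (s *\<^sub>R u - t *\<^sub>R v) w = s * D2 x u w - t * D2 x v w" for s t w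
    using right [of w s t] by (simp add: D2_commute [OF assms, of w])
  have "0 \<le> D2 x (b *\<^sub>R u - a *\<^sub>R v) (b *\<^sub>R u - a *\<^sub>R v)"
    by (rule D2_nonneg [OF assms])
  also have "\<dots> = 2 * (a * b) * (a * b - D2 x u v)"
    unfolding left right sq D2_commute [OF assms, of v u]
    by (simp add: power2_eq_square algebra_simps)
  finally have "0 \<le> a * b - D2 x u v"
    using mult_pos_pos [OF ab] by (simp only: zero_le_mult_iff) linarith
  then show ?thesis
    by (simp add: a_def b_def)
qed

lemma hessian_newton_dir:
  assumes "x \<in> \<Omega>"
  shows "hessian \<phi> x *v newton_dir f x = - gradient \<phi> x"
proof -
  let ?H = "hessian \<phi> x"
  have "u = 0" if "?H *v u = 0" for u
    using pd [OF assms] that unfolding positive_definite_def by (metis inner_zero_right less_irrefl)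
  then have "invertible ?H"
    using invertible_left_inverse matrix_left_invertible_ker by blast
  then have "?H ** matrix_inv ?H = mat 1"
    unfolding invertible_def matrix_inv_def by (rule someI2_ex) simp
  then have "?H *v (matrix_inv ?H *v w) = w" for w
    by (simp add: matrix_vector_mul_assoc)
  then show ?thesis
    by (simp add: newton_dir_def vec.neg)
qed

lemma D2_newton_dir:
  assumes "x \<in> \<Omega>"
  shows "D2 x u (newton_dir f x) = - D1 x u"
  using hessian_inner [OF assms, of u "newton_dir f x"] gradient_inner [OF assms, of u]
  by (simp add: hessian_newton_dir [OF assms])

lemma newton_decrement_eq_local_norm:
  assumes "x \<in> \<Omega>"
  shows "newton_decrement f x = local_norm x (newton_dir f x)"
  using hessian_inner [OF assms] by (simp add: newton_decrement_def local_norm_def)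

lemma newton_decrement_nonneg:
  assumes "x \<in> \<Omega>"
  shows "newton_decrement f x \<ge> 0"
  using assms by (simp add: newton_decrement_eq_local_norm)

lemma D1_newton_dir:
  assumes "x \<in> \<Omega>"
  shows "D1 x (newton_dir f x) = - (newton_decrement f x)\<^sup>2"
  using D2_newton_dir [OF assms, of "newton_dir f x"] local_norm_square [OF assms]
  by (simp add: newton_decrement_eq_local_norm [OF assms])

lemma local_norm_scaleR:
  assumes "x \<in> \<Omega>" "0 \<le> a"
  shows "local_norm x (a *\<^sub>R u) = a * local_norm x u"
proof -
  have "D2 x (a *\<^sub>R u) (a *\<^sub>R u) = a\<^sup>2 * D2 x u u"
    using linear_scale [OF linear_D2 [OF assms(1)]] D2_commute [OF assms(1)]
    by (simp add: power2_eq_square)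
  then show ?thesis
    using assms by (simp add: local_norm_def real_sqrt_mult)
qed

text \<open>The step has local length \<open>\<mu> / (1 + \<mu>) < 1\<close>, which stays inside the Dikin ellipsoid, and the factor
\<open>1 / (1 + \<mu>)\<close> is the one that minimises the upper bound along the Newton direction.\<close>

lemma damped_newton_step:
  fixes x :: "real^'n"
  defines "\<mu> \<equiv> newton_decrement f x"
  assumes "x \<in> \<Omega>"
  shows "x + (1 / (1 + \<mu>)) *\<^sub>R newton_dir f x \<in> \<Omega>"
    and "\<phi> (x + (1 / (1 + \<mu>)) *\<^sub>R newton_dir f x) \<le> \<phi> x - omega \<mu>"
proof -
  have "\<mu> \<ge> 0"
    using newton_decrement_nonneg [OF assms(2)] by (simp add: \<mu>_def)
  let ?t = "1 / (1 + \<mu>)" and ?d = "newton_dir f x"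
  have t: "0 \<le> ?t"
    using \<open>\<mu> \<ge> 0\<close> by simp
  have small: "?t * local_norm x ?d < 1"
    using \<open>\<mu> \<ge> 0\<close> newton_decrement_eq_local_norm [OF assms(2)] by (simp add: \<mu>_def)
  have line: "x + s *\<^sub>R ?d \<in> \<Omega>" if "0 \<le> s" "s \<le> ?t" for s
  proof (rule Dikin_ellipsoid_in_domain [OF assms(2)])
    have "s * local_norm x ?d \<le> ?t * local_norm x ?d"
      using that assms(2) by (intro mult_right_mono) auto
    then show "local_norm x (s *\<^sub>R ?d) < 1"
      using small local_norm_scaleR [OF assms(2) that(1)] by simp
  qed
  show "x + ?t *\<^sub>R ?d \<in> \<Omega>"
    using line [OF t] by simp
  have "\<phi> (x + ?t *\<^sub>R ?d) \<le> \<phi> x + ?t * D1 x ?d + omega_star (?t * local_norm x ?d)"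
    using t line small by (rule upper_bound_along_line)
  also have "\<dots> = \<phi> x - ?t * \<mu>\<^sup>2 + omega_star (?t * \<mu>)"
    using D1_newton_dir [OF assms(2)] newton_decrement_eq_local_norm [OF assms(2)]
    by (simp add: \<mu>_def)
  also have "\<dots> = \<phi> x - omega \<mu>"
  proof -
    have arg: "1 - ?t * \<mu> = ?t"
      using \<open>\<mu> \<ge> 0\<close> by (simp add: field_simps)
    have ln: "ln ?t = - ln (1 + \<mu>)"
      using \<open>\<mu> \<ge> 0\<close> by (simp add: ln_div)
    have "?t * \<mu>\<^sup>2 + ?t * \<mu> = \<mu>"
    proof -
      have "?t * \<mu>\<^sup>2 + ?t * \<mu> = ?t * (1 + \<mu>) * \<mu>"
        by (simp only: power2_eq_square distrib_left distrib_right mult.assoc mult_1 mult_1_right)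
      then show ?thesis
        using \<open>\<mu> \<ge> 0\<close> by simp
    qed
    then show ?thesis
      unfolding omega_def omega_star_def arg ln by linarith
  qed
  finally show "\<phi> (x + ?t *\<^sub>R ?d) \<le> \<phi> x - omega \<mu>" .
qed

text \<open>By Cauchy-Schwarz the linear term of the lower bound is at least \<open>- r \<mu>\<close>, so the gap is at most
\<open>r \<mu> - omega r\<close>, and \<open>omega_star\<close> is the convex conjugate of \<open>omega\<close>.\<close>

lemma gap_le_omega_star:
  assumes "x \<in> \<Omega>" "y \<in> \<Omega>" and small: "newton_decrement f x < 1"
  shows "\<phi> x - \<phi> y \<le> omega_star (newton_decrement f x)"
proof -
  define \<mu> where "\<mu> = newton_decrement f x"
  define r where "r = local_norm x (y - x)"
  have \<mu>: "0 \<le> \<mu>" "\<mu> < 1" and "r \<ge> 0"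
    using assms newton_decrement_nonneg by (simp_all add: \<mu>_def r_def)
  have "x + s *\<^sub>R (y - x) \<in> \<Omega>" if "0 \<le> s" "s \<le> 1" for s
    using assms that by (intro segment_in_domain) auto
  from lower_bound_along_line [OF zero_le_one this]
  have "\<phi> x + D1 x (y - x) + omega r \<le> \<phi> y"
    by (simp add: r_def)
  moreover have "- D1 x (y - x) \<le> r * \<mu>"
    using D2_Cauchy_Schwarz [OF assms(1), of "y - x" "newton_dir f x"] D2_newton_dir [OF assms(1)]
      newton_decrement_eq_local_norm [OF assms(1)] by (simp add: r_def \<mu>_def)
  \<comment> \<open>Fenchel's inequality for the conjugate pair, read off from \<open>ln z \<le> z - 1\<close>.\<close>
  moreover have "ln (1 + r) + ln (1 - \<mu>) \<le> r - \<mu> - r * \<mu>"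
  proof -
    have "ln (1 + r) + ln (1 - \<mu>) = ln ((1 + r) * (1 - \<mu>))"
      using \<mu> \<open>r \<ge> 0\<close> by (simp add: ln_mult)
    also have "\<dots> \<le> (1 + r) * (1 - \<mu>) - 1"
      using \<mu> \<open>r \<ge> 0\<close> by (intro ln_le_minus_one) simp
    finally show ?thesis
      by (simp add: algebra_simps)
  qed
  ultimately show ?thesis
    by (simp add: omega_def omega_star_def flip: \<mu>_def)
qed

text \<open>Moving along \<open>d\<close>, the squared local norm of a fixed \<open>u\<close> has logarithmic derivative at least
\<open>-2 |d| \<ge> -2 r / (1 - s r)\<close>, which is the logarithmic derivative of \<open>(1 - s r)\<^sup>2\<close>. So the quotient
of the two increases, and the norm at the intermediate point is bounded by the norm at the end point.\<close>

lemma local_norm_backwards: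
  fixes x d :: "real^'n" and t :: real
  defines "r \<equiv> local_norm x d"
  assumes line: "\<And>s. 0 \<le> s \<Longrightarrow> s \<le> 1 \<Longrightarrow> x + s *\<^sub>R d \<in> \<Omega>"
    and "r < 1" "0 \<le> t" "t \<le> 1"
  shows "local_norm (x + t *\<^sub>R d) u \<le> (1 - t * r) / (1 - r) * local_norm (x + d) u"
proof -
  have "x \<in> \<Omega>"
    using line [of 0] by simp
  then have "r \<ge> 0"
    by (simp add: r_def)
  have pos: "1 - s * r > 0" if "s \<le> 1" for s
    using that \<open>r \<ge> 0\<close> \<open>r < 1\<close> mult_right_mono [of s 1 r] by simp
  let ?N = "\<lambda>s. D2 (x + s *\<^sub>R d) u u"
  have "?N t / (1 - t * r)\<^sup>2 \<le> ?N 1 / (1 - 1 * r)\<^sup>2"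
  proof (rule DERIV_nonneg_imp_nondecreasing [OF \<open>t \<le> 1\<close>])
    fix s assume s: "t \<le> s" "s \<le> 1"
    then have s0: "0 \<le> s"
      using \<open>0 \<le> t\<close> by simp
    let ?n' = "D3 (x + s *\<^sub>R d) u u d"
    have in_dom: "x + s *\<^sub>R d \<in> \<Omega>"
      using line s0 s by simp
    have "(?N has_real_derivative ?n') (at s)"
      by (rule line_derivatives(3) [OF in_dom])
    moreover have "((\<lambda>s. (1 - s * r)\<^sup>2) has_real_derivative - (2 * r * (1 - s * r))) (at s)"
      by (auto intro!: derivative_eq_intros)
    ultimately have deriv: "((\<lambda>s. ?N s / (1 - s * r)\<^sup>2) has_real_derivative
      (?n' * (1 - s * r)\<^sup>2 - ?N s * - (2 * r * (1 - s * r))) / ((1 - s * r)\<^sup>2 * (1 - s * r)\<^sup>2)) (at s)"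
      by (rule DERIV_divide) (use pos [OF s(2)] in simp)
    have num: "0 \<le> ?n' * (1 - s * r)\<^sup>2 - ?N s * - (2 * r * (1 - s * r))"
    proof -
      have "- ?n' \<le> 2 * (?N s * local_norm (x + s *\<^sub>R d) d)"
        using D3_bound [OF in_dom, of u d] local_norm_square [OF in_dom, of u] by simp
      also have "\<dots> \<le> 2 * (?N s * (r / (1 - s * r)))"
      proof (intro mult_left_mono)
        show "local_norm (x + s *\<^sub>R d) d \<le> r / (1 - s * r)"
          unfolding r_def using s s0 pos [OF s(2)] line
          by (intro local_norm_along_line(2)) (auto simp: r_def)
      qed (use D2_nonneg [OF in_dom] in auto)
      finally have "- ?n' * (1 - s * r)\<^sup>2 \<le> 2 * (?N s * (r / (1 - s * r))) * (1 - s * r)\<^sup>2"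
        by (intro mult_right_mono) auto
      also have "\<dots> = 2 * ?N s * r * (1 - s * r)"
        using pos [OF s(2)] by (simp add: power2_eq_square)
      finally show ?thesis
        by (simp add: mult.assoc)
    qed
    from num have "0 \<le> (?n' * (1 - s * r)\<^sup>2 - ?N s * - (2 * r * (1 - s * r))) / ((1 - s * r)\<^sup>2 * (1 - s * r)\<^sup>2)"
      by (rule divide_nonneg_nonneg) simp
    with deriv show "\<exists>y. ((\<lambda>s. ?N s / (1 - s * r)\<^sup>2) has_real_derivative y) (at s) \<and> 0 \<le> y"
      by blast
  qed
  then have "sqrt (?N t / (1 - t * r)\<^sup>2) \<le> sqrt (?N 1 / (1 - r)\<^sup>2)"
    by simp
  then have "local_norm (x + t *\<^sub>R d) u / (1 - t * r) \<le> local_norm (x + d) u / (1 - r)"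
    using pos [OF \<open>t \<le> 1\<close>] \<open>r < 1\<close> by (simp add: local_norm_def real_sqrt_divide)
  then show ?thesis
    using pos [OF \<open>t \<le> 1\<close>] by (simp add: pos_divide_le_eq mult_ac)
qed

text \<open>Let \<open>y\<close> be the new point. By the choice of \<open>d\<close> the first-order Taylor polynomial of the gradient along
the step vanishes at \<open>y\<close>, so the derivative of \<open>f\<close> at \<open>y\<close> in direction \<open>u\<close> is a pure remainder. The
second derivative of that function along the step is at most \<open>2 |d|\<^sup>2 |u|\<close> in the norms at the
intermediate point, and moving both norms to the end points bounds the remainder by
\<open>(\<mu> / (1 - \<mu>))\<^sup>2\<close> times the norm of \<open>u\<close> at \<open>y\<close>. For \<open>u = - d(y)\<close> both the derivative and this norm
are powers of the decrement at \<open>y\<close>.\<close>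

lemma newton_step:
  fixes x :: "real^'n"
  defines "\<mu> \<equiv> newton_decrement f x"
  assumes "x \<in> \<Omega>" and "\<mu> < 1"
  shows "x + newton_dir f x \<in> \<Omega>"
    and "newton_decrement f (x + newton_dir f x) \<le> (\<mu> / (1 - \<mu>))\<^sup>2"
proof -
  let ?d = "newton_dir f x"
  let ?y = "x + ?d"
  have \<mu>: "\<mu> = local_norm x ?d" "\<mu> \<ge> 0"
    using newton_decrement_eq_local_norm [OF assms(2)] newton_decrement_nonneg [OF assms(2)]
    by (simp_all add: \<mu>_def)
  show y: "?y \<in> \<Omega>"
    using Dikin_ellipsoid_in_domain [OF assms(2)] \<mu> \<open>\<mu> < 1\<close> by simp
  have line: "x + s *\<^sub>R ?d \<in> \<Omega>" if "0 \<le> s" "s \<le> 1" for s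
    using segment_in_domain [OF assms(2) y that] .
  have pos: "1 - s * \<mu> > 0" "1 - \<mu> \<le> 1 - s * \<mu>" if "s \<le> 1" for s
    using that \<mu>(2) \<open>\<mu> < 1\<close> mult_right_mono [of s 1 \<mu>] by auto
  \<comment> \<open>The direction in which the gradient at \<open>y\<close> attains its dual norm.\<close>
  define u where "u = - newton_dir f ?y"
  define K where "K = (\<mu> / (1 - \<mu>))\<^sup>2 * local_norm ?y u"
  let ?G = "\<lambda>s. K * s\<^sup>2 - D1 (x + s *\<^sub>R ?d) u"
  let ?G' = "\<lambda>s. 2 * K * s - D2 (x + s *\<^sub>R ?d) u ?d"
  let ?G'' = "\<lambda>s. 2 * K - D3 (x + s *\<^sub>R ?d) u ?d ?d"
  have "?G 0 + 1 * ?G' 0 \<le> ?G 1"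
  proof (rule second_order_lower_bound [where g'' = ?G'', OF zero_le_one])
    fix s :: real assume s: "0 \<le> s" "s \<le> 1"
    have "((\<lambda>s. K * s\<^sup>2) has_real_derivative 2 * K * s) (at s)"
      by (auto intro!: derivative_eq_intros)
    then show "(?G has_real_derivative ?G' s) (at s)"
      by (rule DERIV_diff [OF _ line_derivatives(2) [OF line [OF s]]])
    have "((\<lambda>s. 2 * K * s) has_real_derivative 2 * K) (at s)"
      by (auto intro!: derivative_eq_intros)
    then show "(?G' has_real_derivative ?G'' s) (at s)"
      by (rule DERIV_diff [OF _ line_derivatives(3) [OF line [OF s]]])
    let ?z = "x + s *\<^sub>R ?d"
    have z: "?z \<in> \<Omega>"
      by (rule line [OF s])
    have "D3 ?z u ?d ?d = D3 ?z ?d ?d u"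
      using D3_commute_left [OF z] D3_commute_right [OF z] by metis
    also have "\<dots> \<le> 2 * ((local_norm ?z ?d)\<^sup>2 * local_norm ?z u)"
      using D3_bound [OF z, of ?d u] by simp
    also have "(local_norm ?z ?d)\<^sup>2 * local_norm ?z u
        \<le> (\<mu> / (1 - s * \<mu>))\<^sup>2 * ((1 - s * \<mu>) / (1 - \<mu>) * local_norm ?y u)"
    proof (intro mult_mono power_mono)
      show "local_norm ?z ?d \<le> \<mu> / (1 - s * \<mu>)"
        unfolding \<mu>(1) using s pos [OF s(2)] line
        by (intro local_norm_along_line(2)) (auto simp: \<mu>(1))
      show "local_norm ?z u \<le> (1 - s * \<mu>) / (1 - \<mu>) * local_norm ?y u"
        unfolding \<mu>(1) using s \<open>\<mu> < 1\<close> line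
        by (intro local_norm_backwards) (auto simp: \<mu>(1))
    qed (use z in auto)
    also have "\<dots> = \<mu>\<^sup>2 / ((1 - s * \<mu>) * (1 - \<mu>)) * local_norm ?y u"
      using pos [OF s(2)] by (simp add: power2_eq_square)
    also have "\<dots> \<le> \<mu>\<^sup>2 / ((1 - \<mu>) * (1 - \<mu>)) * local_norm ?y u"
      using pos [OF s(2)] \<open>\<mu> < 1\<close> y
      by (intro mult_right_mono divide_left_mono mult_pos_pos) auto
    also have "\<dots> = K"
      by (simp add: K_def power_divide power2_eq_square)
    finally show "0 \<le> ?G'' s"
      by simp
  qed
  moreover have "D2 x u ?d = - D1 x u"
    by (rule D2_newton_dir [OF assms(2)])
  ultimately have "D1 ?y u \<le> K"
    by simp
  moreover have "D1 ?y u = (newton_decrement f ?y)\<^sup>2"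
    using D1_newton_dir [OF y] linear_neg [OF linear_D1 [OF y], of "newton_dir f ?y"]
    by (simp add: u_def)
  moreover have "local_norm ?y u = newton_decrement f ?y"
  proof -
    have "D2 ?y u u = D2 ?y (newton_dir f ?y) (newton_dir f ?y)"
      using linear_neg [OF linear_D2 [OF y]] D2_commute [OF y] by (simp add: u_def)
    then show ?thesis
      by (simp add: newton_decrement_eq_local_norm [OF y] local_norm_def)
  qed
  ultimately have "newton_decrement f ?y * newton_decrement f ?y
      \<le> (\<mu> / (1 - \<mu>))\<^sup>2 * newton_decrement f ?y"
    by (simp add: K_def power2_eq_square)
  then show "newton_decrement f ?y \<le> (\<mu> / (1 - \<mu>))\<^sup>2"
    using newton_decrement_nonneg [OF y]
    by (cases "newton_decrement f ?y = 0") auto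
qed

end

section \<open>Counting iterations\<close>

lemma omega_strict_mono:
  assumes "0 \<le> a" "a < b"
  shows "omega a < omega b"
proof (rule DERIV_pos_imp_increasing_open [OF \<open>a < b\<close>])
  fix s assume "a < s" "s < b"
  then have "s > 0"
    using assms by simp
  have "(omega has_real_derivative 1 - 1 / (1 + s)) (at s)"
    unfolding omega_def [abs_def] using \<open>s > 0\<close> by (auto intro!: derivative_eq_intros)
  then show "\<exists>y. (omega has_real_derivative y) (at s) \<and> 0 < y"
    using \<open>s > 0\<close> by (intro exI [of _ "1 - 1 / (1 + s)"]) simp
next
  show "continuous_on {a..b} omega"
    unfolding omega_def [abs_def] using assms by (intro continuous_intros) auto
qed

lemma omega_pos: "0 < t \<Longrightarrow> 0 < omega t"
  using omega_strict_mono [of 0 t] by (simp add: omega_def)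

lemma omega_star_strict_mono:
  assumes "0 \<le> a" "a < b" "b < 1"
  shows "omega_star a < omega_star b"
proof (rule DERIV_pos_imp_increasing_open [OF \<open>a < b\<close>])
  fix s assume "a < s" "s < b"
  then have s: "s > 0" "s < 1"
    using assms by simp_all
  have "(omega_star has_real_derivative 1 / (1 - s) - 1) (at s)"
    unfolding omega_star_def [abs_def] using s by (auto intro!: derivative_eq_intros)
  then show "\<exists>y. (omega_star has_real_derivative y) (at s) \<and> 0 < y"
    using s by (intro exI [of _ "1 / (1 - s) - 1"]) simp
next
  show "continuous_on {a..b} omega_star"
    unfolding omega_star_def [abs_def] using assms by (intro continuous_intros) auto
qed

lemma omega_star_inv:
  assumes "0 \<le> \<delta>"
  shows "0 \<le> omega_star_inv \<delta>" "omega_star_inv \<delta> < 1" "omega_star (omega_star_inv \<delta>) = \<delta>"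
proof -
  \<comment> \<open>A point below one at which \<open>omega_star\<close>, being \<open>\<delta> + 1 - b\<close> there, is at least \<open>\<delta>\<close>.\<close>
  define b where "b = 1 - exp (- (\<delta> + 1))"
  have b: "0 \<le> b" "b < 1"
    using assms by (simp_all add: b_def)
  have "omega_star b = - b + (\<delta> + 1)"
    by (simp add: omega_star_def b_def)
  moreover have "continuous_on {0..b} omega_star"
    unfolding omega_star_def [abs_def] using b by (intro continuous_intros) auto
  ultimately obtain t where t: "0 \<le> t" "t \<le> b" "omega_star t = \<delta>"
    using IVT' [of omega_star 0 \<delta> b] b assms by (auto simp: omega_star_def)
  have "inj_on omega_star {0..<1}"
    by (intro inj_onI) (smt (verit) atLeastLessThan_iff omega_star_strict_mono)
  moreover have "\<delta> \<in> omega_star ` {0..<1}"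
    using t b by force
  ultimately show "omega_star (omega_star_inv \<delta>) = \<delta>"
    "0 \<le> omega_star_inv \<delta>" "omega_star_inv \<delta> < 1"
    using f_the_inv_into_f [of omega_star "{0..<1}" \<delta>]
      the_inv_into_into [of omega_star "{0..<1}" \<delta> "{0..<1}"]
    by (auto simp: omega_star_inv_def)
qed

lemma omega_star_inv_le:
  assumes "0 \<le> \<delta>" "\<delta> \<le> omega_star t" "0 \<le> t" "t < 1"
  shows "omega_star_inv \<delta> \<le> t"
  using omega_star_strict_mono [of t "omega_star_inv \<delta>"] omega_star_inv [OF assms(1)] assms
  by linarith

text \<open>The derivatives \<open>s / (1 + s)\<close> and \<open>s / (1 - s)\<close> have the ratio \<open>(1 - s) / (1 + s)\<close>, which decreases in
\<open>s\<close> and is therefore smallest at the right end point.\<close>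

lemma omega_star_ratio_le_omega:
  assumes "0 \<le> t" "t < 1"
  shows "(1 - t) / (1 + t) * omega_star t \<le> omega t"
proof -
  define c where "c = (1 - t) / (1 + t)"
  have "omega 0 - c * omega_star 0 \<le> omega t - c * omega_star t"
  proof (rule DERIV_nonneg_imp_nondecreasing [OF assms(1)])
    fix s assume s: "0 \<le> s" "s \<le> t"
    have "((\<lambda>s. omega s - c * omega_star s) has_real_derivative
        (1 - 1 / (1 + s)) - c * (1 / (1 - s) - 1)) (at s)"
      unfolding omega_def omega_star_def using s assms by (auto intro!: derivative_eq_intros)
    moreover have "0 \<le> (1 - 1 / (1 + s)) - c * (1 / (1 - s) - 1)"
    proof -
      have "c \<le> (1 - s) / (1 + s)"
        unfolding c_def using s assms by (intro frac_le) auto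
      then have "c * (s / (1 - s)) \<le> (1 - s) / (1 + s) * (s / (1 - s))"
        using s assms by (intro mult_right_mono) auto
      also have "\<dots> = s / (1 + s)"
        using s assms by simp
      also have "s / (1 + s) = 1 - 1 / (1 + s)"
        using s by (simp add: field_simps)
      also have "s / (1 - s) = 1 / (1 - s) - 1"
        using s assms by (simp add: field_simps)
      finally show ?thesis by simp
    qed
    ultimately show "\<exists>y. ((\<lambda>s. omega s - c * omega_star s) has_real_derivative y) (at s) \<and> 0 \<le> y"
      by blast
  qed
  then show ?thesis
    by (simp add: c_def omega_def omega_star_def)
qed

text \<open>The two estimates of the length of the first stage, for the sequence \<open>\<delta>\<close> of gaps and the sequence
\<open>\<mu>\<close> of decrements. The linear one adds up the decreases. The geometric one uses that the gap before
the last step still exceeds \<open>omega \<beta>\<close>, as that step lowers it by more than this amount.\<close>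

lemma first_stage_count:
  fixes \<delta> \<mu> :: "nat \<Rightarrow> real"
  assumes "\<beta> > 0"
    and nonneg: "\<And>k. k \<le> K \<Longrightarrow> \<delta> k \<ge> 0"
    and large: "\<And>k. k < K \<Longrightarrow> \<mu> k > \<beta>"
    and decrease: "\<And>k. k < K \<Longrightarrow> \<delta> (Suc k) \<le> \<delta> k - omega (\<mu> k)"
    and gap: "\<And>k. k < K \<Longrightarrow> \<mu> k < 1 \<Longrightarrow> \<delta> k \<le> omega_star (\<mu> k)"
  shows "int K \<le> first_stage_bound \<beta> (\<delta> 0)"
proof -
  have om: "omega \<beta> > 0"
    by (rule omega_pos [OF \<open>\<beta> > 0\<close>])
  have om_less: "omega \<beta> < omega (\<mu> k)" if "k < K" for k
    using omega_strict_mono large [OF that] \<open>\<beta> > 0\<close> by simp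
  have linear: "\<delta> k + real k * omega \<beta> \<le> \<delta> 0" if "k \<le> K" for k
    using that
  proof (induction k)
    case (Suc k)
    then show ?case
      using decrease [of k] om_less [of k] by (simp add: algebra_simps)
  qed simp
  have bounded: "\<delta> k \<le> \<delta> 0" if "k \<le> K" for k
  proof -
    have "0 \<le> real k * omega \<beta>"
      using om by simp
    then show ?thesis
      using linear [OF that] by linarith
  qed
  have "real K * omega \<beta> \<le> \<delta> 0"
    using linear [of K] nonneg [of K] by simp
  then have "real K \<le> \<delta> 0 / omega \<beta>"
    using om by (simp add: pos_le_divide_eq)
  then have second: "int K \<le> \<lceil>\<delta> 0 / omega \<beta>\<rceil>"
    by linarith
  define t where "t = omega_star_inv (\<delta> 0)"
  define q where "q = 1 - (1 - t) / (1 + t)"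
  have t: "0 \<le> t" "t < 1" "omega_star t = \<delta> 0"
    using omega_star_inv [OF nonneg [of 0]] by (simp_all add: t_def)
  have "int K \<le> \<lceil>max 0 ((ln (omega \<beta>) - ln (\<delta> 0)) / ln q)\<rceil>"
  proof (cases K)
    case 0
    have "0 \<le> max 0 ((ln (omega \<beta>) - ln (\<delta> 0)) / ln q)"
      by simp
    then show ?thesis
      using 0 by linarith
  next
    case (Suc n)
    have q: "0 \<le> q" "q < 1"
      using t by (simp_all add: q_def divide_le_eq)
    have geometric: "\<delta> k \<le> q ^ k * \<delta> 0" if "k \<le> K" for k
      using that
    proof (induction k)
      case (Suc k)
      then have k: "k < K" "k \<le> K"
        by simp_all
      define s where "s = omega_star_inv (\<delta> k)"
      have s: "0 \<le> s" "s < 1" "omega_star s = \<delta> k"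
        using omega_star_inv [OF nonneg [OF k(2)]] by (simp_all add: s_def)
      have "\<delta> k \<le> \<delta> 0"
        by (rule bounded [OF k(2)])
      then have "s \<le> t"
        unfolding s_def using t nonneg [OF k(2)] by (intro omega_star_inv_le) auto
      \<comment> \<open>\<open>omega_star\<close> bounds the gap only for decrements below one, but larger ones exceed \<open>s\<close> anyway.\<close>
      have "s \<le> \<mu> k"
      proof (cases "\<mu> k < 1")
        case True
        then show ?thesis
          unfolding s_def using gap [OF k(1)] nonneg [OF k(2)] large [OF k(1)] \<open>\<beta> > 0\<close>
          by (intro omega_star_inv_le) auto
      qed (use s in simp)
      have "(1 - t) / (1 + t) * \<delta> k \<le> (1 - s) / (1 + s) * \<delta> k"
        using \<open>s \<le> t\<close> s t nonneg [OF k(2)] by (intro mult_right_mono frac_le) auto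
      also have "\<dots> \<le> omega s"
        using omega_star_ratio_le_omega [OF s(1,2)] s(3) by simp
      also have "\<dots> \<le> omega (\<mu> k)"
        using omega_strict_mono [OF s(1), of "\<mu> k"] \<open>s \<le> \<mu> k\<close> by (cases "s = \<mu> k") auto
      finally have "\<delta> (Suc k) \<le> q * \<delta> k"
        using decrease [OF k(1)] by (simp add: q_def left_diff_distrib)
      also have "\<dots> \<le> q * (q ^ k * \<delta> 0)"
        using Suc.IH [OF k(2)] q by (intro mult_left_mono) auto
      finally show ?case
        by simp
    qed simp
    have "n < K"
      using Suc by simp
    have "omega \<beta> < \<delta> n"
      using om_less [OF \<open>n < K\<close>] decrease [OF \<open>n < K\<close>] nonneg [of "Suc n"] Suc by simp
    also have "\<dots> \<le> q ^ n * \<delta> 0"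
      using geometric [of n] \<open>n < K\<close> by simp
    finally have less: "omega \<beta> < q ^ n * \<delta> 0" .
    have "\<delta> 0 > 0"
      using \<open>omega \<beta> < \<delta> n\<close> bounded [of n] \<open>n < K\<close> om by simp
    then have "t \<noteq> 0"
      using t(3) by (auto simp: omega_star_def)
    then have "q > 0"
      using t by (simp add: q_def divide_less_eq)
    have "ln q < 0"
      using q \<open>q > 0\<close> by simp
    have "ln (omega \<beta>) < ln (q ^ n * \<delta> 0)"
      using less om by (subst ln_less_cancel_iff) auto
    also have "\<dots> = real n * ln q + ln (\<delta> 0)"
      using \<open>q > 0\<close> \<open>\<delta> 0 > 0\<close> by (simp add: ln_mult ln_realpow)
    finally have "real n < (ln (omega \<beta>) - ln (\<delta> 0)) / ln q"
      using \<open>ln q < 0\<close> by (simp add: neg_less_divide_eq)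
    then show ?thesis
      using Suc by linarith
  qed
  then show ?thesis
    using second unfolding first_stage_bound_def q_def t_def by simp
qed

text \<open>The threshold is the smaller root of \<open>\<beta> = (1 - \<beta>)\<^sup>2\<close>.\<close>

lemma newton_region:
  assumes "0 < \<beta>" "\<beta> < (3 - sqrt 5) / 2"
  shows "\<beta> < 1" "\<beta> < (1 - \<beta>)\<^sup>2"
proof -
  have "2 < sqrt (5::real)"
    by (rule real_less_rsqrt) simp
  then show "\<beta> < 1"
    using assms by simp
  have "(sqrt 5)\<^sup>2 < (3 - 2 * \<beta>)\<^sup>2"
    using assms by (intro power_strict_mono) auto
  then show "\<beta> < (1 - \<beta>)\<^sup>2"
    by (simp add: power2_eq_square algebra_simps)
qed

lemma newton_map_le:
  fixes m \<beta> :: real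
  assumes "0 \<le> m" "m \<le> \<beta>" "\<beta> < 1"
  shows "(m / (1 - m))\<^sup>2 \<le> m\<^sup>2 / (1 - \<beta>)\<^sup>2"
proof -
  have "(m / (1 - m))\<^sup>2 \<le> (m / (1 - \<beta>))\<^sup>2"
    using assms by (intro power_mono divide_left_mono mult_pos_pos) auto
  then show ?thesis
    by (simp add: power_divide)
qed

lemma newton_map_invariant:
  fixes m \<beta> :: real
  assumes "0 \<le> m" "m \<le> \<beta>" "\<beta> < 1" "\<beta> < (1 - \<beta>)\<^sup>2"
  shows "(m / (1 - m))\<^sup>2 \<le> \<beta>"
proof -
  have "(m / (1 - m))\<^sup>2 \<le> m\<^sup>2 / (1 - \<beta>)\<^sup>2"
    using assms by (intro newton_map_le)
  also have "\<dots> \<le> \<beta>\<^sup>2 / (1 - \<beta>)\<^sup>2"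
    using assms by (intro divide_right_mono power_mono) auto
  also have "\<dots> = \<beta> / (1 - \<beta>)\<^sup>2 * \<beta>"
    by (simp add: power2_eq_square)
  also have "\<dots> \<le> 1 * \<beta>"
    using assms by (intro mult_right_mono) auto
  finally show ?thesis
    by simp
qed

text \<open>With \<open>a = (1 - \<beta>)\<^sup>2\<close>, each step takes the ratio of the decrement to \<open>a\<close> to at most its square, and it starts
at or below \<open>c = \<beta> / a < 1\<close>. At \<open>n = K - 1\<close> this gives \<open>\<epsilon> < a * c ^ (2 ^ n)\<close>, and the bound follows
by taking logarithms twice. For \<open>K = 0\<close> it holds because \<open>\<epsilon> \<le> \<beta>\<close> makes the argument of the outer
logarithm at least one.\<close>

lemma second_stage_count:
  fixes \<mu> :: "nat \<Rightarrow> real"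
  assumes \<beta>: "0 < \<beta>" "\<beta> < (3 - sqrt 5) / 2" and "\<epsilon> > 0"
    and nonneg: "\<And>k. k \<le> K \<Longrightarrow> \<mu> k \<ge> 0"
    and start: "\<mu> 0 \<le> \<beta>"
    and large: "\<And>k. k < K \<Longrightarrow> \<mu> k > \<epsilon>"
    and step: "\<And>k. k < K \<Longrightarrow> \<mu> k < 1 \<Longrightarrow> \<mu> (Suc k) \<le> (\<mu> k / (1 - \<mu> k))\<^sup>2"
  shows "int K \<le> second_stage_bound \<beta> \<epsilon>"
proof -
  note region = newton_region [OF \<beta>]
  define a where "a = (1 - \<beta>)\<^sup>2"
  define c where "c = \<beta> / a"
  have "a > 0"
    using region by (simp add: a_def)
  have "\<beta> < a"
    using region by (simp add: a_def)
  then have c: "0 < c" "c < 1"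
    using \<beta> \<open>a > 0\<close> by (simp_all add: c_def)
  have "\<mu> k \<le> \<beta> \<and> \<mu> k \<le> a * c ^ (2 ^ k)" if "k \<le> K" for k
    using that
  proof (induction k)
    case 0
    then show ?case
      using start \<open>a > 0\<close> by (simp add: c_def)
  next
    case (Suc k)
    then have k: "k < K" "k \<le> K"
      by simp_all
    have IH: "\<mu> k \<le> \<beta>" "\<mu> k \<le> a * c ^ (2 ^ k)" and "\<mu> k \<ge> 0"
      using Suc.IH [OF k(2)] nonneg [OF k(2)] by auto
    have newton: "\<mu> (Suc k) \<le> (\<mu> k / (1 - \<mu> k))\<^sup>2"
      using step [OF k(1)] IH region by simp
    then have 1: "\<mu> (Suc k) \<le> \<beta>"
      using newton_map_invariant [OF \<open>\<mu> k \<ge> 0\<close> IH(1) region] by simp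
    have sq: "\<mu> (Suc k) \<le> (\<mu> k)\<^sup>2 / a"
      unfolding a_def using newton newton_map_le [OF \<open>\<mu> k \<ge> 0\<close> IH(1) region(1)] by simp
    have "(\<mu> k)\<^sup>2 / a \<le> (a * c ^ (2 ^ k))\<^sup>2 / a"
      using IH \<open>\<mu> k \<ge> 0\<close> \<open>a > 0\<close> by (intro divide_right_mono power_mono) auto
    also have "\<dots> = a * c ^ (2 ^ Suc k)"
      using \<open>a > 0\<close> by (simp add: power2_eq_square power_mult mult_ac flip: power_add mult_2)
    finally show ?case
      using 1 sq by simp
  qed
  note bounds = this
  show "int K \<le> second_stage_bound \<beta> \<epsilon>"
  proof (cases "\<epsilon> \<le> \<beta>")
    case False
    then have "K = 0"
      using start large [of 0] by (cases K) auto
    then show ?thesis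
      using False by (simp add: second_stage_bound_def)
  next
    case True
    define R where "R = (ln \<epsilon> - 2 * ln (1 - \<beta>)) / (ln \<beta> - 2 * ln (1 - \<beta>))"
    have ln_a: "ln a = 2 * ln (1 - \<beta>)"
      using region by (simp add: a_def ln_realpow)
    have ln_c: "ln c = ln \<beta> - 2 * ln (1 - \<beta>)" "ln c < 0"
      using \<beta> \<open>a > 0\<close> c by (simp_all add: c_def ln_div flip: ln_a)
    have R: "R = (ln \<epsilon> - ln a) / ln c"
      by (simp add: R_def ln_a ln_c)
    have "int K \<le> \<lceil>log 2 R\<rceil>"
    proof (cases K)
      case 0
      have "ln \<epsilon> - ln a \<le> ln c"
        using True \<open>\<epsilon> > 0\<close> \<beta> by (simp add: ln_a ln_c)
      then have "1 \<le> R"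
        using ln_c(2) by (simp add: R neg_le_divide_eq)
      then have "0 \<le> log 2 R"
        by simp
      then show ?thesis
        by (simp add: 0)
    next
      case (Suc n)
      have "\<epsilon> < a * c ^ (2 ^ n)"
        using large [of n] bounds [of n] Suc by simp
      then have "ln \<epsilon> < ln (a * c ^ (2 ^ n))"
        using \<open>\<epsilon> > 0\<close> by (subst ln_less_cancel_iff) auto
      also have "\<dots> = ln a + 2 ^ n * ln c"
        using \<open>a > 0\<close> c by (simp add: ln_mult ln_realpow)
      finally have "2 ^ n < R"
        using ln_c(2) by (simp add: R neg_less_divide_eq)
      then have "log 2 (2 ^ n) < log 2 R"
        by (subst log_less_cancel_iff) (auto intro: less_trans [of 0 "2 ^ n"])
      then have "real n < log 2 R"
        by simp
      then show ?thesis
        using Suc by linarith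
    qed
    then show ?thesis
      using True by (simp add: second_stage_bound_def R_def)
  qed
qed

context self_concordant_function
begin

lemma first_stage_iterations:
  fixes x :: "nat \<Rightarrow> real^'n"
  assumes "\<beta> > 0" and min: "xstar \<in> \<Omega>" "\<And>y. y \<in> \<Omega> \<Longrightarrow> \<phi> xstar \<le> \<phi> y"
    and dom: "\<And>k. k \<le> K \<Longrightarrow> x k \<in> \<Omega>"
    and step: "\<And>k. k < K \<Longrightarrow> newton_decrement f (x k) > \<beta> \<and>
        x (Suc k) = x k + (1 / (1 + newton_decrement f (x k))) *\<^sub>R newton_dir f (x k)"
  shows "int K \<le> first_stage_bound \<beta> (\<phi> (x 0) - \<phi> xstar)"
proof (rule first_stage_count [where \<mu> = "\<lambda>k. newton_decrement f (x k)"
      and \<delta> = "\<lambda>k. \<phi> (x k) - \<phi> xstar"])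
  fix k assume k: "k < K"
  then have "x k \<in> \<Omega>"
    using dom by simp
  show "newton_decrement f (x k) > \<beta>"
    using step [OF k] by simp
  show "\<phi> (x (Suc k)) - \<phi> xstar \<le> \<phi> (x k) - \<phi> xstar - omega (newton_decrement f (x k))"
    using damped_newton_step(2) [OF \<open>x k \<in> \<Omega>\<close>] step [OF k] by simp
  show "\<phi> (x k) - \<phi> xstar \<le> omega_star (newton_decrement f (x k))"
    if "newton_decrement f (x k) < 1"
    using gap_le_omega_star [OF \<open>x k \<in> \<Omega>\<close> min(1) that] .
qed (use assms in auto)

lemma second_stage_iterations:
  fixes x :: "nat \<Rightarrow> real^'n"
  assumes \<beta>: "0 < \<beta>" "\<beta> < (3 - sqrt 5) / 2" and "\<epsilon> > 0"
    and dom: "\<And>k. k \<le> K \<Longrightarrow> x k \<in> \<Omega>"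
    and start: "newton_decrement f (x 0) \<le> \<beta>"
    and step: "\<And>k. k < K \<Longrightarrow> newton_decrement f (x k) > \<epsilon> \<and> x (Suc k) = x k + newton_dir f (x k)"
  shows "int K \<le> second_stage_bound \<beta> \<epsilon>"
proof (rule second_stage_count [OF \<beta> \<open>\<epsilon> > 0\<close>, where \<mu> = "\<lambda>k. newton_decrement f (x k)"])
  fix k assume k: "k < K"
  then have "x k \<in> \<Omega>"
    using dom by simp
  show "newton_decrement f (x (Suc k)) \<le> (newton_decrement f (x k) / (1 - newton_decrement f (x k)))\<^sup>2"
    if "newton_decrement f (x k) < 1"
    using newton_step(2) [OF \<open>x k \<in> \<Omega>\<close> that] step [OF k] by simp
qed (use assms newton_decrement_nonneg in auto)

text \<open>If the threshold were never reached, every initial piece of the infinite sequence of steps would obey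
the same bound on its length.\<close>

lemma first_stage_terminates:
  assumes "\<beta> > 0" "x0 \<in> \<Omega>" and min: "xstar \<in> \<Omega>" "\<And>y. y \<in> \<Omega> \<Longrightarrow> \<phi> xstar \<le> \<phi> y"
  obtains x K where "x 0 = x0" "\<And>k. x k \<in> \<Omega>" "newton_decrement f (x K) \<le> \<beta>"
    "\<And>k. k < K \<Longrightarrow> newton_decrement f (x k) > \<beta> \<and>
       x (Suc k) = x k + (1 / (1 + newton_decrement f (x k))) *\<^sub>R newton_dir f (x k)"
proof -
  define step where "step z = z + (1 / (1 + newton_decrement f z)) *\<^sub>R newton_dir f z" for z
  define x where "x k = (step ^^ k) x0" for k
  have x_Suc: "x (Suc k) = step (x k)" for k
    by (simp add: x_def)
  have dom: "x k \<in> \<Omega>" for k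
  proof (induction k)
    case (Suc k)
    then show ?case
      using damped_newton_step(1) by (simp add: x_Suc step_def)
  qed (simp add: x_def assms)
  have "\<exists>k. newton_decrement f (x k) \<le> \<beta>"
  proof (rule ccontr)
    assume none: "\<nexists>k. newton_decrement f (x k) \<le> \<beta>"
    have "int K \<le> first_stage_bound \<beta> (\<phi> (x 0) - \<phi> xstar)" for K
      using none by (intro first_stage_iterations [OF \<open>\<beta> > 0\<close> min dom])
        (auto simp: x_Suc step_def not_le)
    from this [of "Suc (nat (first_stage_bound \<beta> (\<phi> (x 0) - \<phi> xstar)))"] show False
      by linarith
  qed
  then obtain K where K: "newton_decrement f (x K) \<le> \<beta>"
    "\<And>k. k < K \<Longrightarrow> \<not> newton_decrement f (x k) \<le> \<beta>"
    using exists_least_iff [of "\<lambda>k. newton_decrement f (x k) \<le> \<beta>"] by blast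
  show thesis
    by (rule that [of x K]) (use dom K in \<open>auto simp: x_Suc step_def not_le x_def\<close>)
qed

lemma second_stage_terminates:
  assumes \<beta>: "0 < \<beta>" "\<beta> < (3 - sqrt 5) / 2" and "\<epsilon> > 0"
    and z0: "z0 \<in> \<Omega>" "newton_decrement f z0 \<le> \<beta>"
  obtains z K where "z 0 = z0" "\<And>k. z k \<in> \<Omega>" "newton_decrement f (z K) \<le> \<epsilon>"
    "\<And>k. k < K \<Longrightarrow> newton_decrement f (z k) > \<epsilon> \<and> z (Suc k) = z k + newton_dir f (z k)"
proof -
  define step where "step z = z + newton_dir f z" for z
  define z where "z k = (step ^^ k) z0" for k
  have z_Suc: "z (Suc k) = step (z k)" for k
    by (simp add: z_def)
  have "z 0 = z0"
    by (simp add: z_def)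
  note region = newton_region [OF \<beta>]
  have inv: "(\<forall>j\<le>k. z j \<in> \<Omega>) \<and> newton_decrement f (z k) \<le> \<beta>" for k
  proof (induction k)
    case (Suc k)
    then have k: "z k \<in> \<Omega>" "newton_decrement f (z k) < 1"
      using region by auto
    have dom: "z j \<in> \<Omega>" if "j \<le> Suc k" for j
      using newton_step(1) [OF k] Suc that by (cases "j = Suc k") (auto simp: z_Suc step_def)
    have "newton_decrement f (z (Suc k)) \<le> \<beta>"
      using newton_step(2) [OF k] newton_map_invariant [OF newton_decrement_nonneg [OF k(1)] _ region] Suc
      by (simp add: z_Suc step_def)
    then show ?case
      using dom by blast
  qed (simp add: z_def z0)
  then have dom: "z k \<in> \<Omega>" for k
    by blast
  have "\<exists>k. newton_decrement f (z k) \<le> \<epsilon>"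
  proof (rule ccontr)
    assume none: "\<nexists>k. newton_decrement f (z k) \<le> \<epsilon>"
    have "int K \<le> second_stage_bound \<beta> \<epsilon>" for K
      using none z0(2) dom
      by (intro second_stage_iterations [OF \<beta> \<open>\<epsilon> > 0\<close>, where x = z])
        (auto simp: z_Suc step_def not_le \<open>z 0 = z0\<close>)
    from this [of "Suc (nat (second_stage_bound \<beta> \<epsilon>))"] show False
      by linarith
  qed
  then obtain K where K: "newton_decrement f (z K) \<le> \<epsilon>"
    "\<And>k. k < K \<Longrightarrow> \<not> newton_decrement f (z k) \<le> \<epsilon>"
    using exists_least_iff [of "\<lambda>k. newton_decrement f (z k) \<le> \<epsilon>"] by blast
  show thesis
    by (rule that [of z K]) (use dom K in \<open>auto simp: z_Suc step_def not_le z_def\<close>)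
qed

end

theorem theorem4p4:
  fixes f :: "real^'n \<Rightarrow> ereal" and x0 xstar :: "real^'n" and \<beta> \<epsilon> \<delta>\<^sub>0 :: real
  assumes "standard_self_concordant f"
    and "\<And>x. x \<in> edom f \<Longrightarrow> positive_definite (hessian (real_part f) x)"
    and "unique_minimizer f xstar"
    and "x0 \<in> edom f"
    and "0 < \<beta>" and "\<beta> < (3 - sqrt 5) / 2"
    and "\<epsilon> > 0"
    and "\<delta>\<^sub>0 = real_part f x0 - real_part f xstar"
  shows "(\<exists>x K1 K2. mixed_newton_run f x0 \<beta> \<epsilon> x K1 K2) \<and>
    (\<forall>x K1 K2. mixed_newton_run f x0 \<beta> \<epsilon> x K1 K2 \<longrightarrow>
       int K2 \<le> first_stage_bound \<beta> \<delta>\<^sub>0 + second_stage_bound \<beta> \<epsilon>)"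
proof -
  interpret self_concordant_function f
    using assms(1,2) by unfold_locales
  have le: "f xstar \<le> f y" for y
    using assms(3) by (simp add: unique_minimizer_def)
  have min: "xstar \<in> edom f"
    using le [of x0] assms(4) by (auto simp: edom_def)
  have finite: "f y \<noteq> - \<infinity>" for y
    using assms(1) by (simp add: standard_self_concordant_def)
  have min': "real_part f xstar \<le> real_part f y" if "y \<in> edom f" for y
    using le [of y] that min finite [of xstar] finite [of y]
    by (cases "f xstar"; cases "f y") (auto simp: edom_def real_part_def)
  obtain y K1 where y: "y 0 = x0" "\<And>k. y k \<in> edom f" "newton_decrement f (y K1) \<le> \<beta>"
    "\<And>k. k < K1 \<Longrightarrow> newton_decrement f (y k) > \<beta> \<and>
       y (Suc k) = y k + (1 / (1 + newton_decrement f (y k))) *\<^sub>R newton_dir f (y k)"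
    using first_stage_terminates [OF assms(5,4) min min'] by blast
  obtain z K where z: "z 0 = y K1" "\<And>k. z k \<in> edom f" "newton_decrement f (z K) \<le> \<epsilon>"
    "\<And>k. k < K \<Longrightarrow> newton_decrement f (z k) > \<epsilon> \<and> z (Suc k) = z k + newton_dir f (z k)"
    using second_stage_terminates [OF assms(5-7) y(2,3)] by blast
  define x where "x k = (if k \<le> K1 then y k else z (k - K1))" for k
  have x_late: "x k = z (k - K1)" if "K1 \<le> k" for k
    using that z(1) by (cases "k = K1") (auto simp: x_def)
  have "mixed_newton_run f x0 \<beta> \<epsilon> x K1 (K1 + K)"
    unfolding mixed_newton_run_def
  proof (intro conjI allI impI)
    show "x 0 = x0" "x k \<in> edom f" for k
      using y z by (auto simp: x_def)
    show "newton_decrement f (x K1) \<le> \<beta>" "newton_decrement f (x (K1 + K)) \<le> \<epsilon>"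
      using y z x_late [of "K1 + K"] by (simp_all add: x_def)
    show "newton_decrement f (x k) > \<beta>"
      "x (Suc k) = x k + (1 / (1 + newton_decrement f (x k))) *\<^sub>R newton_dir f (x k)"
      if "k < K1" for k
      using y(4) [OF that] that by (simp_all add: x_def)
    show "newton_decrement f (x k) > \<epsilon>" "x (Suc k) = x k + newton_dir f (x k)"
      if "K1 \<le> k \<and> k < K1 + K" for k
    proof -
      have "k - K1 < K"
        using that by linarith
      then show "newton_decrement f (x k) > \<epsilon>" "x (Suc k) = x k + newton_dir f (x k)"
        using z(4) x_late [of k] x_late [of "Suc k"] that by (simp_all add: Suc_diff_le)
    qed
  qed simp
  moreover have "int K2 \<le> first_stage_bound \<beta> \<delta>\<^sub>0 + second_stage_bound \<beta> \<epsilon>"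
    if run: "mixed_newton_run f x0 \<beta> \<epsilon> x K1 K2" for x K1 K2
  proof -
    have "K1 \<le> K2" "x 0 = x0"
      using run by (simp_all add: mixed_newton_run_def)
    have "int K1 \<le> first_stage_bound \<beta> (real_part f (x 0) - real_part f xstar)"
      using run by (intro first_stage_iterations [OF assms(5) min min'])
        (auto simp: mixed_newton_run_def)
    moreover have "int (K2 - K1) \<le> second_stage_bound \<beta> \<epsilon>"
      using run by (intro second_stage_iterations [OF assms(5-7), where x = "\<lambda>k. x (K1 + k)"])
        (auto simp: mixed_newton_run_def)
    ultimately show ?thesis
      using \<open>K1 \<le> K2\<close> \<open>x 0 = x0\<close> assms(8) by (simp add: of_nat_diff)
  qed
  ultimately show ?thesis
    by blast
qed

end
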